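(* Suppose that (A1) $\beta_\ast$ is random with $\mathbb{E}[\beta_\ast]=0$ and $\mathbb{E}[\beta_\ast\beta_\ast^\top]=\frac{\alpha^2}{p}I_p$ for some $\alpha>0$ and is independent of $X_n,\tilde x,\varepsilon_n,\tilde\varepsilon$; (A2) there exists $\delta>0$ with $\mathbb{E}[|Z_{ij}|^{4+\delta}],\mathbb{E}[|\tilde z_j|^{4+\delta}]<+\infty$ for all $i,j$; (A3) there exists $\gamma_{\max}>0$ with $\sup_{n\ge1}\max_{1\le i\le n,\,1\le j\le p}\{|\gamma_{ij}^{(n)}|,|\tilde\gamma_j^{(n)}|\}<\gamma_{\max}$. Then $$\lim_{\lambda\to+\infty}r_\lambda^{test}(X_n)=\frac{\alpha^2}{p}\operatorname{Tr}[\widetilde S_p]+\sigma^2 .$$ Suppose moreover that (A4) there exists $\gamma_{\min}>0$ with $\min_{1\le i\le n,\,1\le j\le p}\{|\gamma_{ij}^{(n)}|,|\tilde\gamma_j^{(n)}|\}\ge\gamma_{\min}$ for all $n\ge1$; (A5) there exists $d_\ast>0$ with $|\frac pn-1|\ge d_\ast$ for all values of $n$ and $p$. Then: - if $\frac pn<1$, $$\lim_{\lambda\to0^+}r_\lambda^{test}(X_n)=\frac{\sigma^2}{n}\operatorname{Tr}[\widetilde S_pT_p(0^-)]+\sigma^2;$$ - if $\frac pn>1$, $$\lim_{\lambda\to0^+}r_\lambda^{test}(X_n)=\frac{\alpha^2}{p}\operatorname{Tr}\bigl[\widetilde S_p\,\kappa(0^+)(\Sigma_n+\kappa(0^+))^{-1}\bigr]+\frac{\sigma^2}{n}\operatorname{Tr}\bigl[\kappa'(0^+)\widetilde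 S_p\Sigma_n(\Sigma_n+\kappa(0^+))^{-2}\bigr]+\sigma^2,$$ where $\kappa'(\lambda)$ is the derivative of $\kappa(\lambda)$ with respect to $\lambda$.
   Context: Design: $X_n=\Upsilon_n\circ Z_n\in\mathbb{R}^{n\times p}$, where $\circ$ is the entrywise product, $\Upsilon_n=(\gamma_{ij}^{(n)})$ is a deterministic real $n\times p$ matrix, and $Z_n=(Z_{ij})$ is a real random matrix with i.i.d. centered entries of variance one. Write $\gamma_{ij}=\gamma_{ij}^{(n)}$ and $\Sigma_n=\frac1n\operatorname{diag}\bigl(\sum_{i=1}^n\gamma_{i1}^2,\dots,\sum_{i=1}^n\gamma_{ip}^2\bigr)$. Model: $Y_n=X_n\beta_\ast+\varepsilon_n$, where $\varepsilon_n\in\mathbb{R}^n$ has i.i.d. entries with mean $0$ and variance $\sigma^2>0$, independent of $X_n$. Test point: $\tilde y=\tilde x^\top\beta_\ast+\tilde\varepsilon$, $\mathbb{E}[\tilde\varepsilon]=0$, $\mathbb{E}[\tilde\varepsilon^2]=\sigma^2$, $\tilde x=\widetilde S_p^{1/2}\tilde z$, where $\tilde z=(\tilde z_j)\in\mathbb{R}^p$ has i.i.d. centered entries of variance one and $\widetilde S_p=\operatorname{diag}(\tilde\gamma_1^2,\dots,\tilde\gamma_p^2)$ is deterministic ($\tilde\gamma_j=\tilde\gamma_j^{(n)}$). Let $D_i=\operatorname{diag}(\gamma_{i1}^2,\dots,\gamma_{ip}^2)$ and $\widetilde D_j=\operatorname{diag}(\gamma_{1j}^2,\dots,\gamma_{nj}^2)$.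 For $z\in\mathbb{C}\setminus\mathbb{R}^+$ ($\mathbb{R}^+=[0,\infty)$), the diagonal matrices $T_p(z)=\operatorname{diag}(T_p^{(j)}(z))_{1\le j\le p}$ and $\widetilde T_n(z)=\operatorname{diag}(\widetilde T_n^{(i)}(z))_{1\le i\le n}$ are the unique solution of $$T_p^{(j)}(z)=\frac{-1}{z\bigl(1+\frac1n\operatorname{Tr}[\widetilde D_j\widetilde T_n(z)]\bigr)},\qquad \widetilde T_n^{(i)}(z)=\frac{-1}{z\bigl(1+\frac1n\operatorname{Tr}[D_iT_p(z)]\bigr)},$$ in the class where every entry is the Stieltjes transform $z\mapsto\int\frac{\mu(dt)}{t-z}$ of a probability measure $\mu$ on $[0,\infty)$; $T_p'$ is the derivative of $T_p$ in $z$. The deterministic equivalent of the predictive risk of ridge regression with parameter $\lambda>0$ is $$r_\lambda^{test}(X_n)=\sigma^2+\frac{\sigma^2}{n}\operatorname{Tr}[\widetilde S_pT_p(-\lambda)]+\lambda\Bigl(\frac{\lambda\alpha^2}{p}-\frac{\sigma^2}{n}\Bigr)\operatorname{Tr}[\widetilde S_pT_p'(-\lambda)].$$ For $\lambda>0$, $\kappa(\lambda)=\operatorname{diag}(\kappa_1(\lambda),\dots,\kappa_p(\lambda))$ with $\kappa_j(\lambda)=\operatorname{Tr}[\widetilde D_j]/\operatorname{Tr}[\widetilde D_j\widetilde T_n(-\lambda)]$. When $p<n$, $T_p(0^-)=\lim_{\lambda\to0^+}T_p(-\lambda)$; when $p>n$, $\kappa(0^+)=\lim_{\lambda\to0^+}\kappa(\lambda)$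 and $\kappa'(0^+)=\lim_{\lambda\to0^+}\kappa'(\lambda)$ (these limits exist under (A2)–(A5)). *)

theory Defs
  imports "HOL-Probability.Probability"
begin

text \<open>
  Vectors and matrices are functions on the 1-based index ranges \<open>{1..n}\<close> and \<open>{1..p}\<close>.
  Every matrix inside a trace is diagonal and is given by the function of its diagonal
  entries, so products and inverses are entrywise and a trace is the sum of the entries.
\<close>

subsection \<open>The regression model\<close>

definition iid_centered ::
  "'w measure \<Rightarrow> 'i set \<Rightarrow> ('i \<Rightarrow> 'w \<Rightarrow> real) \<Rightarrow> real \<Rightarrow> bool" where
  "iid_centered M I X v \<longleftrightarrow>
     prob_space.indep_vars M (\<lambda>_. borel) X I \<and>
     (\<forall>i\<in>I. \<forall>j\<in>I. distr M borel (X i) = distr M borel (X j)) \<and>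
     (\<forall>i\<in>I. integrable M (X i) \<and> integrable M (\<lambda>w. (X i w)\<^sup>2) \<and>
            (\<integral>w. X i w \<partial>M) = 0 \<and> (\<integral>w. (X i w)\<^sup>2 \<partial>M) = v)"

text \<open>A family of real random variables as one random element of the product space.\<close>

definition joint :: "'i set \<Rightarrow> ('i \<Rightarrow> 'w \<Rightarrow> real) \<Rightarrow> 'w \<Rightarrow> 'i \<Rightarrow> real" where
  "joint I X w = (\<lambda>i\<in>I. X i w)"

abbreviation vec_borel :: "'i set \<Rightarrow> ('i \<Rightarrow> real) measure" where
  "vec_borel I \<equiv> PiM I (\<lambda>_. borel)"

text \<open>The library constant \<open>indep_var\<close> forces both variables to have the same codomain type.\<close>

definition indep_random_elements ::
  "'w measure \<Rightarrow> 'a measure \<Rightarrow> ('w \<Rightarrow> 'a) \<Rightarrow> 'b measure \<Rightarrow> ('w \<Rightarrow> 'b) \<Rightarrow> bool" where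
  "indep_random_elements M A X B Y \<longleftrightarrow>
     X \<in> M \<rightarrow>\<^sub>M A \<and> Y \<in> M \<rightarrow>\<^sub>M B \<and>
     prob_space.indep_set M {X -` S \<inter> space M |S. S \<in> sets A} {Y -` S \<inter> space M |S. S \<in> sets B}"

text \<open>The entries of the entrywise product of the variance profile with the noise matrix.\<close>

definition design ::
  "(nat \<Rightarrow> nat \<Rightarrow> real) \<Rightarrow> (nat \<Rightarrow> nat \<Rightarrow> 'w \<Rightarrow> real) \<Rightarrow> nat \<times> nat \<Rightarrow> 'w \<Rightarrow> real" where
  "design \<Upsilon> Z = (\<lambda>(i, j) w. \<Upsilon> i j * Z i j w)"

text \<open>The entries of the test covariate; \<open>sqrt ((\<gamma>t j)\<^sup>2)\<close> is the entry of the positive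
  square root of the diagonal covariance, so the sign of \<open>\<gamma>t j\<close> is lost.\<close>

definition test_covariate ::
  "(nat \<Rightarrow> real) \<Rightarrow> (nat \<Rightarrow> 'w \<Rightarrow> real) \<Rightarrow> nat \<Rightarrow> 'w \<Rightarrow> real" where
  "test_covariate \<gamma>t zt j w = sqrt ((\<gamma>t j)\<^sup>2) * zt j w"

definition regression_model ::
  "'w measure \<Rightarrow> nat \<Rightarrow> nat \<Rightarrow> (nat \<Rightarrow> nat \<Rightarrow> real) \<Rightarrow> (nat \<Rightarrow> real) \<Rightarrow> real \<Rightarrow>
   (nat \<Rightarrow> nat \<Rightarrow> 'w \<Rightarrow> real) \<Rightarrow> (nat \<Rightarrow> 'w \<Rightarrow> real) \<Rightarrow> (nat \<Rightarrow> 'w \<Rightarrow> real) \<Rightarrow>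
   (nat \<Rightarrow> 'w \<Rightarrow> real) \<Rightarrow> (nat \<Rightarrow> 'w \<Rightarrow> real) \<Rightarrow> ('w \<Rightarrow> real) \<Rightarrow> ('w \<Rightarrow> real) \<Rightarrow> bool" where
  "regression_model M n p \<Upsilon> \<gamma>t \<sigma> Z \<beta> \<epsilon> Y zt \<epsilon>t yt \<longleftrightarrow>
     iid_centered M ({1..n} \<times> {1..p}) (\<lambda>(i, j). Z i j) 1 \<and>
     iid_centered M {1..n} \<epsilon> (\<sigma>\<^sup>2) \<and>
     indep_random_elements M
       (vec_borel {1..n}) (joint {1..n} \<epsilon>)
       (vec_borel ({1..n} \<times> {1..p})) (joint ({1..n} \<times> {1..p}) (design \<Upsilon> Z)) \<and>
     (\<forall>i\<in>{1..n}. \<forall>w\<in>space M. Y i w = (\<Sum>j\<in>{1..p}. design \<Upsilon> Z (i, j) w * \<beta> j w) + \<epsilon> i w) \<and>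
     iid_centered M {1..p} zt 1 \<and>
     integrable M \<epsilon>t \<and> integrable M (\<lambda>w. (\<epsilon>t w)\<^sup>2) \<and>
     (\<integral>w. \<epsilon>t w \<partial>M) = 0 \<and> (\<integral>w. (\<epsilon>t w)\<^sup>2 \<partial>M) = \<sigma>\<^sup>2 \<and>
     (\<forall>w\<in>space M. yt w = (\<Sum>j\<in>{1..p}. test_covariate \<gamma>t zt j w * \<beta> j w) + \<epsilon>t w)"

text \<open>Mean zero, covariance \<open>\<alpha>\<^sup>2 / p\<close> times the identity, and independence of the tuple
  of training covariates, test covariate, training noise and test noise.\<close>

definition random_coefficients ::
  "'w measure \<Rightarrow> nat \<Rightarrow> nat \<Rightarrow> (nat \<Rightarrow> nat \<Rightarrow> real) \<Rightarrow> (nat \<Rightarrow> real) \<Rightarrow> real \<Rightarrow>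
   (nat \<Rightarrow> nat \<Rightarrow> 'w \<Rightarrow> real) \<Rightarrow> (nat \<Rightarrow> 'w \<Rightarrow> real) \<Rightarrow> (nat \<Rightarrow> 'w \<Rightarrow> real) \<Rightarrow>
   (nat \<Rightarrow> 'w \<Rightarrow> real) \<Rightarrow> ('w \<Rightarrow> real) \<Rightarrow> bool" where
  "random_coefficients M n p \<Upsilon> \<gamma>t \<alpha> Z \<beta> \<epsilon> zt \<epsilon>t \<longleftrightarrow>
     (\<forall>j\<in>{1..p}. integrable M (\<beta> j) \<and> (\<integral>w. \<beta> j w \<partial>M) = 0) \<and>
     (\<forall>j\<in>{1..p}. \<forall>k\<in>{1..p}. integrable M (\<lambda>w. \<beta> j w * \<beta> k w) \<and>
        (\<integral>w. \<beta> j w * \<beta> k w \<partial>M) = (if j = k then \<alpha>\<^sup>2 / real p else 0)) \<and>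
     indep_random_elements M
       (vec_borel {1..p}) (joint {1..p} \<beta>)
       (vec_borel ({1..n} \<times> {1..p}) \<Otimes>\<^sub>M vec_borel {1..p} \<Otimes>\<^sub>M vec_borel {1..n} \<Otimes>\<^sub>M borel)
       (\<lambda>w. (joint ({1..n} \<times> {1..p}) (design \<Upsilon> Z) w,
             joint {1..p} (test_covariate \<gamma>t zt) w,
             joint {1..n} \<epsilon> w,
             \<epsilon>t w))"


subsection \<open>The deterministic equivalent\<close>

definition stieltjes_transform_nonneg :: "(complex \<Rightarrow> complex) \<Rightarrow> bool" where
  "stieltjes_transform_nonneg f \<longleftrightarrow>
     (\<exists>\<mu>. real_distribution \<mu> \<and> measure \<mu> {0..} = 1 \<and>
          (\<forall>z. z \<notin> \<real>\<^sub>\<ge>\<^sub>0 \<longrightarrow> f z = (\<integral>t. 1 / (complex_of_real t - z) \<partial>\<mu>)))"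

text \<open>The system determines \<open>T j\<close> for \<open>j \<in> {1..p}\<close> and \<open>Tt i\<close> for \<open>i \<in> {1..n}\<close> off the
  nonnegative real axis only; no other values of these functions matter below.\<close>

definition fixed_point_solution ::
  "nat \<Rightarrow> nat \<Rightarrow> (nat \<Rightarrow> nat \<Rightarrow> real) \<Rightarrow>
   (nat \<Rightarrow> complex \<Rightarrow> complex) \<Rightarrow> (nat \<Rightarrow> complex \<Rightarrow> complex) \<Rightarrow> bool" where
  "fixed_point_solution n p \<Upsilon> T Tt \<longleftrightarrow>
     (\<forall>j\<in>{1..p}. stieltjes_transform_nonneg (T j)) \<and>
     (\<forall>i\<in>{1..n}. stieltjes_transform_nonneg (Tt i)) \<and>
     (\<forall>z. z \<notin> \<real>\<^sub>\<ge>\<^sub>0 \<longrightarrow>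
        (\<forall>j\<in>{1..p}. T j z =
           - 1 / (z * (1 + 1 / of_nat n * (\<Sum>i\<in>{1..n}. of_real ((\<Upsilon> i j)\<^sup>2) * Tt i z)))) \<and>
        (\<forall>i\<in>{1..n}. Tt i z =
           - 1 / (z * (1 + 1 / of_nat n * (\<Sum>j\<in>{1..p}. of_real ((\<Upsilon> i j)\<^sup>2) * T j z)))))"

text \<open>The risk is complex-valued only because the Stieltjes transforms are: their values and
  derivatives at \<open>- lam < 0\<close> are real.\<close>

definition risk_equiv ::
  "real \<Rightarrow> real \<Rightarrow> nat \<Rightarrow> nat \<Rightarrow> (nat \<Rightarrow> real) \<Rightarrow> (nat \<Rightarrow> complex \<Rightarrow> complex) \<Rightarrow>
   real \<Rightarrow> complex" where
  "risk_equiv \<sigma> \<alpha> n p \<gamma>t T lam =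
     of_real (\<sigma>\<^sup>2)
     + of_real (\<sigma>\<^sup>2 / real n) * (\<Sum>j\<in>{1..p}. of_real ((\<gamma>t j)\<^sup>2) * T j (- of_real lam))
     + of_real (lam * (lam * \<alpha>\<^sup>2 / real p - \<sigma>\<^sup>2 / real n))
       * (\<Sum>j\<in>{1..p}. of_real ((\<gamma>t j)\<^sup>2) * deriv (T j) (- of_real lam))"

definition avg_variance :: "nat \<Rightarrow> (nat \<Rightarrow> nat \<Rightarrow> real) \<Rightarrow> nat \<Rightarrow> real" where
  "avg_variance n \<Upsilon> j = 1 / real n * (\<Sum>i\<in>{1..n}. (\<Upsilon> i j)\<^sup>2)"

definition kappa ::
  "nat \<Rightarrow> (nat \<Rightarrow> nat \<Rightarrow> real) \<Rightarrow> (nat \<Rightarrow> complex \<Rightarrow> complex) \<Rightarrow> nat \<Rightarrow> real \<Rightarrow> complex" where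
  "kappa n \<Upsilon> Tt j lam =
     of_real (\<Sum>i\<in>{1..n}. (\<Upsilon> i j)\<^sup>2)
     / (\<Sum>i\<in>{1..n}. of_real ((\<Upsilon> i j)\<^sup>2) * Tt i (- of_real lam))"

end

theory Submission
  imports Defs
begin

text \<open>
  Fix \<open>n\<close>. At \<open>z = - l\<close> the entries of \<open>T\<close>, \<open>Tt\<close> and their derivatives are the moments
  \<open>\<integral> 1 / (s + l) ^ k\<close>, \<open>k = 1, 2\<close>, which decrease in \<open>l\<close>, so limits at \<open>0+\<close> reduce to bounds.
  With \<open>x j = l * T j (- l)\<close>, the risk is
  \<open>\<sigma>\<^sup>2 + \<sigma>\<^sup>2/n * (\<Sum>j. \<gamma>t j\<^sup>2 * x' j) + \<alpha>\<^sup>2/p * (\<Sum>j. \<gamma>t j\<^sup>2 * (x j - l * x' j))\<close>.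
  Summing the fixed-point equations gives \<open>(\<Sum>i. l * Tt i) - (\<Sum>j. l * T j) = n - p\<close>; hence the
  smaller of the two families stays bounded as \<open>l \<rightarrow> 0\<close>. If \<open>p < n\<close>, then \<open>x' j \<rightarrow> T j (0-)\<close> and
  \<open>x j \<rightarrow> 0\<close>. If \<open>p > n\<close>, differentiating the system also bounds the derivatives of \<open>Tt\<close>, and
  \<open>x j = \<kappa> j / (\<Sigma> j + \<kappa> j)\<close> yields the stated limits.
\<close>

section \<open>Moments of a distribution on the half-line\<close>

definition moment :: "real measure \<Rightarrow> nat \<Rightarrow> real \<Rightarrow> real" where
  "moment \<mu> k l = (\<integral>s. 1 / (s + l) ^ k \<partial>\<mu>)"

text \<open>The error of the difference quotient is exactly
  \<open>h / ((w - h) * w\<^sup>2)\<close>. The bound depends on \<open>w\<close> only through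
  \<open>l\<close>, so it can be integrated over \<open>w = s + l\<close> and allows differentiation
  under the integral sign.\<close>

lemma norm_difference_quotient_inverse_le:
  fixes w h :: complex
  assumes l: "0 < l" and w: "l \<le> norm w" and wh: "l / 2 \<le> norm (w - h)" and h: "h \<noteq> 0"
  shows "norm ((1 / (w - h) - 1 / w) / h - 1 / w\<^sup>2) \<le> 2 / l ^ 3 * norm h"
proof -
  have "w \<noteq> 0" using w l by auto
  moreover have wh0: "w - h \<noteq> 0" using wh l by auto
  ultimately have "1 / (w - h) - 1 / w = h / ((w - h) * w)"
    by (simp add: diff_frac_eq)
  then have "(1 / (w - h) - 1 / w) / h - 1 / w\<^sup>2 = 1 / ((w - h) * w) - 1 / (w * w)"
    using h by (simp add: power2_eq_square)
  also have "\<dots> = h / ((w - h) * w\<^sup>2)"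
  proof -
    \<comment> \<open>With \<open>h\<close> written as \<open>w - v\<close>, only two nonzero
      unknowns remain and clearing denominators gives a polynomial identity.\<close>
    define v where "v = w - h"
    have "v \<noteq> 0" "w - h = v" "h = w - v" using wh0 by (simp_all add: v_def)
    then show ?thesis
      using \<open>w \<noteq> 0\<close> by (simp only:) (simp add: field_simps power2_eq_square)
  qed
  finally have "norm ((1 / (w - h) - 1 / w) / h - 1 / w\<^sup>2) = norm h / (norm (w - h) * (norm w)\<^sup>2)"
    by (simp only: norm_divide norm_mult norm_power)
  also have "\<dots> \<le> norm h / (l / 2 * l\<^sup>2)"
    using l by (intro divide_left_mono mult_mono power_mono w wh mult_pos_pos zero_less_power)
      (use w wh in auto)
  also have "\<dots> = 2 / l ^ 3 * norm h"
    by (simp add: power2_eq_square power3_eq_cube mult_ac)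
  finally show ?thesis .
qed

text \<open>The measure lives on the whole real line, as in
  \<open>stieltjes_transform_nonneg\<close>; the sign of \<open>s\<close> is therefore available
  only almost everywhere, through \<open>AE_nonneg\<close>.\<close>

locale nonneg_distribution = real_distribution +
  assumes measure_nonneg_half_line: "measure M {0..} = 1"
begin

lemma AE_nonneg: "AE s in M. 0 \<le> s"
proof -
  have "AE s in M. s \<in> {0..}"
    using measure_nonneg_half_line by (intro AE_prob_1) auto
  then show ?thesis by simp
qed

lemma integrable_inverse_power:
  assumes "0 < l"
  shows "integrable M (\<lambda>s. 1 / (s + l) ^ k)"
proof (rule integrable_const_bound[where B = "1 / l ^ k"])
  show "AE s in M. norm (1 / (s + l) ^ k) \<le> 1 / l ^ k"
    using AE_nonneg
    by eventually_elim (use assms in \<open>auto intro!: divide_left_mono power_mono mult_pos_pos simp: norm_divide norm_power\<close>)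
qed measurable

lemma integral_scaled: "(\<integral>s. c * (1 / (s + l) ^ k) \<partial>M) = c * moment M k l"
  unfolding moment_def by (rule integral_mult_right_zero)

lemma moment_mono:
  assumes "0 < l" and "l \<le> m"
  shows "moment M k m \<le> moment M k l"
  unfolding moment_def
proof (rule integral_mono_AE)
  show "AE s in M. 1 / (s + m) ^ k \<le> 1 / (s + l) ^ k"
    using AE_nonneg
    by eventually_elim (use assms in \<open>auto intro!: divide_left_mono power_mono mult_pos_pos\<close>)
qed (use assms in \<open>auto intro!: integrable_inverse_power\<close>)

lemma moment_nonneg: "0 < l \<Longrightarrow> 0 \<le> moment M k l"
  unfolding moment_def
  by (rule integral_nonneg_AE) (use AE_nonneg in eventually_elim, simp)

lemma moment_le:
  assumes "0 < l"
  shows "moment M 1 l \<le> 1 / l"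
proof -
  have "moment M 1 l \<le> (\<integral>s. 1 / l \<partial>M)"
    unfolding moment_def
  proof (rule integral_mono_AE)
    show "AE s in M. 1 / (s + l) ^ 1 \<le> 1 / l"
      using AE_nonneg
      by eventually_elim (use assms in \<open>auto intro!: divide_left_mono mult_pos_pos\<close>)
  qed (use integrable_inverse_power[OF assms, of 1] in auto)
  then show ?thesis using prob_space by simp
qed

text \<open>For \<open>s \<ge> 0\<close> the number \<open>q = l / (s + l)\<close> lies in
  \<open>[0, 1]\<close>, hence \<open>q\<^sup>2 \<le> q\<close>. Together with
  \<open>second_moment_ge\<close> this squeezes the second moment as \<open>l\<close> tends to
  infinity.\<close>

lemma second_moment_le:
  assumes "0 < l"
  shows "l\<^sup>2 * moment M 2 l \<le> l * moment M 1 l"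
proof -
  have "(\<integral>s. l\<^sup>2 * (1 / (s + l) ^ 2) \<partial>M) \<le> (\<integral>s. l * (1 / (s + l) ^ 1) \<partial>M)"
  proof (rule integral_mono_AE)
    show "AE s in M. l\<^sup>2 * (1 / (s + l) ^ 2) \<le> l * (1 / (s + l) ^ 1)"
      using AE_nonneg
      by eventually_elim (use assms in \<open>auto simp: divide_simps power2_eq_square\<close>)
  qed (intro integrable_mult_right integrable_inverse_power assms)+
  then show ?thesis unfolding integral_scaled .
qed

text \<open>Integrates \<open>0 \<le> (1 - l / (s + l))\<^sup>2\<close>.\<close>

lemma second_moment_ge:
  assumes "0 < l"
  shows "2 * (l * moment M 1 l) - 1 \<le> l\<^sup>2 * moment M 2 l"
proof -
  have i: "integrable M (\<lambda>s. 2 * l * (1 / (s + l) ^ 1))" "integrable M (\<lambda>s. l\<^sup>2 * (1 / (s + l) ^ 2))"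
    by (intro integrable_mult_right integrable_inverse_power assms)+
  have "(\<integral>s. 2 * l * (1 / (s + l) ^ 1) - 1 \<partial>M) \<le> (\<integral>s. l\<^sup>2 * (1 / (s + l) ^ 2) \<partial>M)"
  proof (rule integral_mono_AE)
    show "AE s in M. 2 * l * (1 / (s + l) ^ 1) - 1 \<le> l\<^sup>2 * (1 / (s + l) ^ 2)"
    \<comment> \<open>The inequality holds for every real \<open>s\<close>, not just almost
      everywhere: at \<open>s = - l\<close> division by zero returns 0 and it reads
      \<open>- 1 \<le> 0\<close>.\<close>
    proof (intro AE_I2)
      fix s
      show "2 * l * (1 / (s + l) ^ 1) - 1 \<le> l\<^sup>2 * (1 / (s + l) ^ 2)"
        using zero_le_power2[of "1 - l / (s + l)"]
        by (simp add: power2_diff power_divide)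
    qed
  qed (use i in auto)
  moreover have "(\<integral>s. 2 * l * (1 / (s + l) ^ 1) - 1 \<partial>M) = 2 * l * moment M 1 l - 1"
    using i(1) prob_space
    by (subst Bochner_Integration.integral_diff) (simp_all only: integral_scaled integrable_const, simp)
  ultimately show ?thesis unfolding integral_scaled by simp
qed

text \<open>The integrand on the right is \<open>(l / 2) / ((s + l / 2) * (s + l))\<close>, which
  only decreases when \<open>s + l / 2\<close> is replaced by \<open>s + l\<close>. The second
  moment is thus controlled by an increment of the first.\<close>

lemma second_moment_le_diff:
  assumes "0 < l"
  shows "l / 2 * moment M 2 l \<le> moment M 1 (l / 2) - moment M 1 l"
proof -
  have i: "integrable M (\<lambda>s. 1 / (s + l / 2) ^ 1)" "integrable M (\<lambda>s. 1 / (s + l) ^ 1)"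
    "integrable M (\<lambda>s. l / 2 * (1 / (s + l) ^ 2))"
    by (intro integrable_mult_right integrable_inverse_power; use assms in simp)+
  have "(\<integral>s. l / 2 * (1 / (s + l) ^ 2) \<partial>M)
      \<le> (\<integral>s. 1 / (s + l / 2) ^ 1 - 1 / (s + l) ^ 1 \<partial>M)"
  proof (rule integral_mono_AE)
    show "AE s in M. l / 2 * (1 / (s + l) ^ 2) \<le> 1 / (s + l / 2) ^ 1 - 1 / (s + l) ^ 1"
      using AE_nonneg
    proof eventually_elim
      fix s :: real assume "0 \<le> s"
      then have "1 / (s + l / 2) ^ 1 - 1 / (s + l) ^ 1 = (l / 2) / ((s + l / 2) * (s + l))"
        using assms by (simp add: field_simps)
      moreover have "l / 2 * (1 / (s + l) ^ 2) \<le> (l / 2) / ((s + l / 2) * (s + l))"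
        using assms \<open>0 \<le> s\<close>
        by (auto simp: power2_eq_square intro!: divide_left_mono mult_right_mono)
      ultimately show "l / 2 * (1 / (s + l) ^ 2) \<le> 1 / (s + l / 2) ^ 1 - 1 / (s + l) ^ 1"
        by simp
    qed
  qed (use i in auto)
  moreover have "(\<integral>s. 1 / (s + l / 2) ^ 1 - 1 / (s + l) ^ 1 \<partial>M) = moment M 1 (l / 2) - moment M 1 l"
    unfolding moment_def by (rule Bochner_Integration.integral_diff) (use i in auto)
  ultimately show ?thesis unfolding integral_scaled by simp
qed

text \<open>A bounded decreasing function of \<open>l\<close> converges to its supremum as
  \<open>l\<close> falls to 0. The domination by \<open>L\<close> is kept because later bounds must
  hold for all \<open>l > 0\<close>, not only in the limit.\<close>

lemma moment_limit:
  assumes "\<And>l. 0 < l \<Longrightarrow> moment M k l \<le> B"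
  shows "\<exists>L. (moment M k \<longlongrightarrow> L) (at_right 0) \<and> (\<forall>l>0. moment M k l \<le> L)"
proof -
  define L where "L = Sup (moment M k ` {0<..})"
  have bdd: "bdd_above (moment M k ` {0<..})"
    using assms by (auto intro!: bdd_aboveI[of _ B])
  have le: "moment M k l \<le> L" if "0 < l" for l
    unfolding L_def using that by (intro cSup_upper bdd) auto
  have "(moment M k \<longlongrightarrow> L) (at_right 0)"
  proof (rule order_tendstoI)
    fix c assume "c < L"
    \<comment> \<open>One point \<open>m\<close> above \<open>c\<close> suffices, since by
      monotonicity every smaller \<open>l\<close> also gives a value above \<open>c\<close>.\<close>
    then obtain m where "0 < m" "c < moment M k m"
      using less_cSup_iff[OF _ bdd, of c] unfolding L_def by auto
    then show "\<forall>\<^sub>F l in at_right 0. c < moment M k l"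
      unfolding eventually_at_right_field
      using moment_mono by (intro exI[of _ m]) (force intro: less_le_trans)
  next
    fix c assume "L < c"
    then show "\<forall>\<^sub>F l in at_right 0. moment M k l < c"
      unfolding eventually_at_right_field using le by (intro exI[of _ 1]) (auto intro: le_less_trans)
  qed
  with le show ?thesis by blast
qed

text \<open>In \<open>second_moment_le_diff\<close> both first moments have the same limit, so their
  difference vanishes. The second moment itself may still diverge.\<close>

lemma second_moment_scaled_tendsto_0:
  assumes lim: "(moment M 1 \<longlongrightarrow> L) (at_right 0)"
  shows "((\<lambda>l. l * moment M 2 l) \<longlongrightarrow> 0) (at_right 0)"
proof (rule tendsto_sandwich[where f = "\<lambda>_. 0"])
  have "filterlim (\<lambda>l::real. l / 2) (at_right 0) (at_right 0)"
    by (auto simp: filterlim_at eventually_at_right_field intro!: tendsto_eq_intros exI[of _ 1])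
  from filterlim_compose[OF lim this]
  have "((\<lambda>l. moment M 1 (l / 2)) \<longlongrightarrow> L) (at_right 0)" .
  then have "((\<lambda>l. 2 * (moment M 1 (l / 2) - moment M 1 l)) \<longlongrightarrow> 2 * (L - L)) (at_right 0)"
    by (intro tendsto_intros lim)
  then show "((\<lambda>l. 2 * (moment M 1 (l / 2) - moment M 1 l)) \<longlongrightarrow> 0) (at_right 0)"
    by simp
  show "\<forall>\<^sub>F l in at_right 0. 0 \<le> l * moment M 2 l"
    by (auto simp: eventually_at_right_field intro!: exI[of _ 1] mult_nonneg_nonneg moment_nonneg)
  show "\<forall>\<^sub>F l in at_right 0. l * moment M 2 l \<le> 2 * (moment M 1 (l / 2) - moment M 1 l)"
    unfolding eventually_at_right_field
    using second_moment_le_diff by (intro exI[of _ 1]) force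
qed simp

section \<open>Stieltjes transforms on the negative half-line\<close>

text \<open>Differentiation under the integral sign with an explicit error: the pointwise error is
  at most \<open>2 / l ^ 3 * norm h\<close> uniformly in \<open>s \<ge> 0\<close>, and integrating
  against a probability measure preserves this bound.\<close>

lemma stieltjes_has_field_derivative:
  assumes f: "\<And>z. z \<notin> \<real>\<^sub>\<ge>\<^sub>0 \<Longrightarrow> f z = (\<integral>s. 1 / (complex_of_real s - z) \<partial>M)"
    and l: "0 < l"
  shows "f (- of_real l) = of_real (moment M 1 l)"
    and "(f has_field_derivative of_real (moment M 2 l)) (at (- of_real l))"
proof -
  have off: "z \<notin> \<real>\<^sub>\<ge>\<^sub>0" if "Re z < 0" for z
    using that by (auto simp: complex_nonneg_Reals_iff)
  show "f (- of_real l) = of_real (moment M 1 l)"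
    unfolding moment_def integral_complex_of_real[symmetric]
    using f[OF off, of "- of_real l"] l by simp
  let ?q = "\<lambda>h s. 1 / (complex_of_real s + of_real l - h)"
  let ?g = "\<lambda>s. 1 / (complex_of_real s + of_real l)\<^sup>2"
  \<comment> \<open>Only real parts are compared: \<open>Re h < l / 2\<close> leaves at least
    \<open>l / 2\<close> of \<open>s + l\<close>. The same restriction keeps \<open>- l + h\<close>
    in the left half-plane, where the integral formula for \<open>f\<close> applies.\<close>
  have low: "l / 2 \<le> norm (complex_of_real s + of_real l - h)"
    if "0 \<le> s" "norm h < l / 2" for s h
  proof -
    have "Re h < l / 2" using complex_Re_le_cmod[of h] that by linarith
    then show ?thesis
      using complex_Re_le_cmod[of "complex_of_real s + of_real l - h"] that by simp
  qed
  have int_q: "integrable M (?q h)" if "norm h < l / 2" for h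
  proof (rule integrable_const_bound[where B = "2 / l"])
    show "AE s in M. norm (?q h s) \<le> 2 / l"
      using AE_nonneg
    proof eventually_elim
      fix s :: real assume "0 \<le> s"
      with low[OF this that] l show "norm (?q h s) \<le> 2 / l"
        by (auto simp: norm_divide divide_simps mult.commute)
    qed
  qed measurable
  have g: "?g s = complex_of_real (1 / (s + l) ^ 2)" for s by simp
  have int_g: "integrable M ?g"
    unfolding g using integrable_inverse_power[OF l, of 2] by (rule integrable_of_real)
  have moment2: "of_real (moment M 2 l) = (\<integral>s. ?g s \<partial>M)"
    unfolding moment_def g integral_complex_of_real ..
  have quotient: "norm ((f (- of_real l + h) - f (- of_real l)) / h - of_real (moment M 2 l))
      \<le> 2 / l ^ 3 * norm h" if "h \<noteq> 0" "norm h < l / 2" for h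
  proof -
    have "Re h < l / 2" using complex_Re_le_cmod[of h] that by linarith
    then have fh: "f (- of_real l + h) = (\<integral>s. ?q h s \<partial>M)"
      using f[OF off, of "- of_real l + h"] l by (simp add: algebra_simps)
    have f0: "f (- of_real l) = (\<integral>s. ?q 0 s \<partial>M)"
      using f[OF off, of "- of_real l"] l by simp
    have int_q0: "integrable M (?q 0)" using int_q[of 0] l by simp
    note int_div = integrable_divide[OF Bochner_Integration.integrable_diff[OF int_q[OF that(2)] int_q0]]
    note int_diff = Bochner_Integration.integrable_diff[OF int_div[of h] int_g]
    have eq: "(f (- of_real l + h) - f (- of_real l)) / h - of_real (moment M 2 l)
        = (\<integral>s. (?q h s - ?q 0 s) / h - ?g s \<partial>M)"
      unfolding fh f0 moment2
      using int_q[OF that(2)] int_q[of 0] int_g l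
      by (simp add: Bochner_Integration.integral_diff integrable_divide integral_divide_zero)
    have "norm ((f (- of_real l + h) - f (- of_real l)) / h - of_real (moment M 2 l))
        \<le> (\<integral>s. norm ((?q h s - ?q 0 s) / h - ?g s) \<partial>M)"
      unfolding eq by (rule integral_norm_bound)
    also have "\<dots> \<le> (\<integral>s. 2 / l ^ 3 * norm h \<partial>M)"
    proof (rule integral_mono_AE)
      show "integrable M (\<lambda>s. norm ((?q h s - ?q 0 s) / h - ?g s))"
        by (rule integrable_norm[OF int_diff])
      show "AE s in M. norm ((?q h s - ?q 0 s) / h - ?g s) \<le> 2 / l ^ 3 * norm h"
        using AE_nonneg
      proof eventually_elim
        fix s :: real assume "0 \<le> s"
        have w: "l \<le> norm (complex_of_real s + of_real l)"
          using complex_Re_le_cmod[of "complex_of_real s + of_real l"] \<open>0 \<le> s\<close> by simp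
        have wh: "l / 2 \<le> norm (complex_of_real s + of_real l - h)"
          by (rule low) fact+
        show "norm ((?q h s - ?q 0 s) / h - ?g s) \<le> 2 / l ^ 3 * norm h"
          using norm_difference_quotient_inverse_le[OF l w wh that(1)] by simp
      qed
    qed (rule integrable_const)
    also have "\<dots> = 2 / l ^ 3 * norm h" using prob_space by simp
    finally show ?thesis .
  qed
  show "(f has_field_derivative of_real (moment M 2 l)) (at (- of_real l))"
    unfolding DERIV_def
  proof (rule LIM_zero_cancel, rule Lim_null_comparison)
    show "\<forall>\<^sub>F h in at 0. norm ((f (- of_real l + h) - f (- of_real l)) / h - of_real (moment M 2 l))
        \<le> 2 / l ^ 3 * norm h"
      unfolding eventually_at using quotient l by (intro exI[of _ "l / 2"]) (simp add: dist_norm)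
    show "((\<lambda>h::complex. 2 / l ^ 3 * norm h) \<longlongrightarrow> 0) (at 0)"
      by (rule tendsto_mult_right_zero) (rule tendsto_norm_zero, rule tendsto_ident_at)
  qed
qed

text \<open>The complex derivative is followed along the path \<open>- l\<close>; the chain rule
  produces the minus sign.\<close>

lemma has_real_derivative_moment:
  assumes l: "0 < l"
  shows "(moment M 1 has_real_derivative - moment M 2 l) (at l)"
proof -
  \<comment> \<open>Defining \<open>f\<close> by the integral at every \<open>z\<close> makes the
    representation hypothesis of \<open>stieltjes_has_field_derivative\<close> hold by
    definition.\<close>
  define f where "f z = (\<integral>s. 1 / (complex_of_real s - z) \<partial>M)" for z
  note f = stieltjes_has_field_derivative[of f, OF f_def]
  have "((\<lambda>l. - complex_of_real l) has_vector_derivative - 1) (at l)"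
    by (auto intro!: derivative_eq_intros simp: has_vector_derivative_of_real)
  from field_vector_diff_chain_at[OF this f(2)[OF l]]
  have "((\<lambda>l. Re (f (- of_real l))) has_vector_derivative Re (- 1 * of_real (moment M 2 l))) (at l)"
    unfolding o_def by (rule bounded_linear.has_vector_derivative[OF bounded_linear_Re])
  then have "((\<lambda>l. Re (f (- of_real l))) has_real_derivative - moment M 2 l) (at l)"
    by (simp add: has_real_derivative_iff_has_vector_derivative)
  moreover have "\<forall>\<^sub>F l in nhds l. moment M 1 l = Re (f (- of_real l))"
    using eventually_nhds_in_open[of "{0<..}" l] l
    by (auto elim!: eventually_mono simp: f(1) simp del: One_nat_def)
  ultimately show ?thesis by (subst DERIV_cong_ev[OF refl _ refl])
qed

end

section \<open>The fixed-point system at negative real arguments\<close>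

text \<open>The factor \<open>c\<close> is kept apart from \<open>1 / real n\<close> so that
  exchanging rows and columns gives another instance with the same \<open>c\<close>;
  \<open>u_bounded\<close> relies on this symmetry.\<close>

locale variance_profile =
  fixes n p :: nat and c :: real and a :: "nat \<Rightarrow> nat \<Rightarrow> real" and \<mu> \<nu> :: "nat \<Rightarrow> real measure"
  assumes n_pos: "n \<ge> 1" and p_pos: "p \<ge> 1"
    and c_pos: "0 < c" and a_nonneg: "\<And>i j. 0 \<le> a i j"
    and row_distribution: "\<And>i. i \<in> {1..n} \<Longrightarrow> nonneg_distribution (\<nu> i)"
    and column_distribution: "\<And>j. j \<in> {1..p} \<Longrightarrow> nonneg_distribution (\<mu> j)"
    and column_equation: "\<And>j l. j \<in> {1..p} \<Longrightarrow> 0 < l \<Longrightarrow>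
      l * moment (\<mu> j) 1 l = 1 / (1 + c * (\<Sum>i\<in>{1..n}. a i j * moment (\<nu> i) 1 l))"
    and row_equation: "\<And>i l. i \<in> {1..n} \<Longrightarrow> 0 < l \<Longrightarrow>
      l * moment (\<nu> i) 1 l = 1 / (1 + c * (\<Sum>j\<in>{1..p}. a i j * moment (\<mu> j) 1 l))"
begin

abbreviation "t j \<equiv> moment (\<mu> j) 1"
abbreviation "u i \<equiv> moment (\<nu> i) 1"
abbreviation "v i \<equiv> moment (\<nu> i) 2"

definition "A j l = c * (\<Sum>i\<in>{1..n}. a i j * u i l)"
definition "B i l = c * (\<Sum>j\<in>{1..p}. a i j * t j l)"
text \<open>This is \<open>l * t j l\<close> on the index range, by \<open>scaled_t\<close>.
  Expressed through \<open>A\<close> it can have a positive limit at 0 even when \<open>t j\<close>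
  diverges.\<close>

definition "x j l = 1 / (1 + A j l)"
text \<open>\<open>W\<close> is minus the derivative of \<open>A\<close>, and \<open>x'\<close>
  below is the resulting derivative of \<open>x\<close>.\<close>

definition "W j l = c * (\<Sum>i\<in>{1..n}. a i j * v i l)"
definition "x' j l = (x j l)\<^sup>2 * W j l"

lemma A_nonneg: "0 < l \<Longrightarrow> 0 \<le> A j l"
  unfolding A_def
  by (intro mult_nonneg_nonneg less_imp_le[OF c_pos] sum_nonneg a_nonneg
      nonneg_distribution.moment_nonneg row_distribution)

lemma B_nonneg: "0 < l \<Longrightarrow> 0 \<le> B i l"
  unfolding B_def
  by (intro mult_nonneg_nonneg less_imp_le[OF c_pos] sum_nonneg a_nonneg
      nonneg_distribution.moment_nonneg column_distribution)

lemma scaled_t: "j \<in> {1..p} \<Longrightarrow> 0 < l \<Longrightarrow> l * t j l = x j l"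
  using column_equation unfolding x_def A_def by simp

lemma scaled_u: "i \<in> {1..n} \<Longrightarrow> 0 < l \<Longrightarrow> l * u i l = 1 / (1 + B i l)"
  using row_equation unfolding B_def by simp

lemma x_times_A: "0 < l \<Longrightarrow> x j l * A j l = 1 - x j l"
  using A_nonneg[of l j] by (simp add: x_def field_simps)

lemma t_nonneg: "j \<in> {1..p} \<Longrightarrow> 0 < l \<Longrightarrow> 0 \<le> t j l"
  by (intro nonneg_distribution.moment_nonneg column_distribution)

lemma u_nonneg: "i \<in> {1..n} \<Longrightarrow> 0 < l \<Longrightarrow> 0 \<le> u i l"
  by (intro nonneg_distribution.moment_nonneg row_distribution)

lemma v_nonneg: "i \<in> {1..n} \<Longrightarrow> 0 < l \<Longrightarrow> 0 \<le> v i l"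
  by (intro nonneg_distribution.moment_nonneg row_distribution)

lemma u_pos:
  assumes "i \<in> {1..n}" "0 < l"
  shows "0 < u i l"
proof -
  have "0 < l * u i l"
    unfolding scaled_u[OF assms] using B_nonneg[OF assms(2), of i] by simp
  then show ?thesis using assms(2) by (simp add: zero_less_mult_iff)
qed

text \<open>\<open>l * u i l = 1 - l * u i l * B i l\<close> and \<open>l * t j l = 1 - l * t j l * A j l\<close>, with equal
  double sums of the subtracted terms.\<close>

lemma balance:
  assumes "0 < l"
  shows "(\<Sum>i\<in>{1..n}. l * u i l) - (\<Sum>j\<in>{1..p}. l * t j l) = real n - real p"
proof -
  have "l * u i l + l * u i l * B i l = 1" if "i \<in> {1..n}" for i
    unfolding scaled_u[OF that assms] using B_nonneg[OF assms, of i] by (simp add: field_simps)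
  then have "(\<Sum>i\<in>{1..n}. l * u i l + l * u i l * B i l) = real n" by simp
  moreover have "l * t j l + l * t j l * A j l = 1" if "j \<in> {1..p}" for j
    unfolding scaled_t[OF that assms] using x_times_A[OF assms, of j] by simp
  then have "(\<Sum>j\<in>{1..p}. l * t j l + l * t j l * A j l) = real p" by simp
  moreover have "(\<Sum>i\<in>{1..n}. l * u i l * B i l) = (\<Sum>j\<in>{1..p}. l * t j l * A j l)"
    unfolding A_def B_def sum_distrib_left by (subst sum.swap) (simp add: mult_ac)
  ultimately show ?thesis by (simp add: sum.distrib)
qed

text \<open>By \<open>balance\<close> the average of \<open>l * u i l\<close> over the rows is at
  least \<open>(n - p) / n\<close>, so some row reaches this value. Its equation bounds
  \<open>B i l\<close>, which dominates \<open>c * m * t j l\<close>. The row may depend on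
  \<open>l\<close>, but the bound does not.\<close>

lemma t_bounded:
  assumes "p < n" "0 < m" and m: "\<And>i j. i \<in> {1..n} \<Longrightarrow> j \<in> {1..p} \<Longrightarrow> m \<le> a i j"
    and j: "j \<in> {1..p}" and l: "0 < l"
  shows "t j l \<le> real n / ((real n - real p) * c * m)"
proof -
  define q where "q = (real n - real p) / real n"
  have q: "0 < q" using assms(1) by (simp add: q_def)
  have "\<exists>i\<in>{1..n}. q \<le> l * u i l"
  proof (rule ccontr)
    assume "\<not> ?thesis"
    then have "(\<Sum>i\<in>{1..n}. l * u i l) < (\<Sum>i\<in>{1..n}. q)"
      using n_pos by (intro sum_strict_mono) (auto simp: not_le)
    also have "\<dots> = real n - real p" using n_pos by (simp add: q_def)
    finally have "(\<Sum>j\<in>{1..p}. l * t j l) < 0" using balance[OF l] by simp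
    moreover have "0 \<le> (\<Sum>j\<in>{1..p}. l * t j l)"
      using l by (intro sum_nonneg mult_nonneg_nonneg t_nonneg) auto
    ultimately show False by simp
  qed
  then obtain i where i: "i \<in> {1..n}" "q \<le> 1 / (1 + B i l)" using scaled_u l by auto
  have "a i j * t j l \<le> (\<Sum>j\<in>{1..p}. a i j * t j l)"
    using j l by (intro member_le_sum) (auto intro!: mult_nonneg_nonneg a_nonneg t_nonneg simp del: One_nat_def)
  then have "m * t j l \<le> (\<Sum>j\<in>{1..p}. a i j * t j l)"
    using mult_right_mono[OF m[OF i(1) j] t_nonneg[OF j l]] by linarith
  also have "\<dots> = B i l / c" using c_pos by (simp add: B_def)
  also have "\<dots> \<le> (1 / q) / c"
    using i(2) q B_nonneg[OF l, of i] c_pos by (intro divide_right_mono) (auto simp: field_simps)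
  finally have "t j l \<le> (1 / q) / c / m"
    using assms(2) by (simp only: pos_le_divide_eq mult.commute)
  then show ?thesis by (simp add: q_def mult_ac)
qed

section \<open>Differentiating the fixed-point system\<close>

lemma has_real_derivative_A:
  assumes l: "0 < l"
  shows "(A j has_real_derivative - W j l) (at l)"
proof -
  have "((\<lambda>l. A j l) has_real_derivative c * (\<Sum>i\<in>{1..n}. a i j * - v i l)) (at l)"
    unfolding A_def
    by (intro DERIV_cmult DERIV_sum nonneg_distribution.has_real_derivative_moment row_distribution l)
  then show ?thesis by (simp add: W_def sum_negf)
qed

lemma has_real_derivative_x:
  assumes l: "0 < l"
  shows "(x j has_real_derivative x' j l) (at l)"
proof -
  have "((\<lambda>l. 1 / (1 + A j l)) has_real_derivative x' j l) (at l)"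
    using A_nonneg[OF l, of j] has_real_derivative_A[OF l, of j]
    by (auto intro!: derivative_eq_intros simp: x'_def x_def power2_eq_square field_simps)
  then show ?thesis unfolding x_def[abs_def] .
qed

text \<open>Differentiates \<open>t j l = x j l / l\<close> by the quotient rule and compares with
  \<open>has_real_derivative_moment\<close>. It lets the risk be written without second moments of
  \<open>\<mu>\<close>.\<close>

lemma second_moment_t_eq:
  assumes j: "j \<in> {1..p}" and l: "0 < l"
  shows "l * moment (\<mu> j) 2 l = t j l - x' j l"
proof -
  have "((\<lambda>l. x j l / l) has_real_derivative (x' j l * l - x j l * 1) / (l * l)) (at l)"
    using l by (intro DERIV_divide has_real_derivative_x DERIV_ident) auto
  moreover have "\<forall>\<^sub>F l in nhds l. t j l = x j l / l"
    using eventually_nhds_in_open[of "{0<..}" l] l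
    by (auto elim!: eventually_mono simp: scaled_t[OF j, symmetric])
  ultimately have "(t j has_real_derivative (x' j l * l - x j l * 1) / (l * l)) (at l)"
    by (subst DERIV_cong_ev[OF refl _ refl])
  then have "- moment (\<mu> j) 2 l = (x' j l * l - x j l * 1) / (l * l)"
    by (rule DERIV_unique[OF nonneg_distribution.has_real_derivative_moment[OF column_distribution[OF j] l]])
  then have "l * moment (\<mu> j) 2 l = x j l / l - x' j l"
    using l by (simp add: field_simps)
  also have "x j l / l = t j l" using l by (simp add: scaled_t[OF j l, symmetric])
  finally show ?thesis .
qed

text \<open>Since \<open>x'\<close> is linear in \<open>v\<close> through \<open>W\<close>, this
  closes a linear system for the second moments \<open>v\<close> alone.\<close>

lemma v_eq:
  assumes i: "i \<in> {1..n}" and l: "0 < l"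
  shows "v i l = (u i l)\<^sup>2 * (1 + c * (\<Sum>j\<in>{1..p}. a i j * x' j l))"
proof -
  \<comment> \<open>Multiplying the factor \<open>l\<close> into the row equation turns each
    \<open>t\<close> into \<open>x\<close>, whose derivative is already known.\<close>
  have u_eq: "u i l = 1 / (l + c * (\<Sum>j\<in>{1..p}. a i j * x j l))" if l: "0 < l" for l
  proof -
    have "l * B i l = c * (\<Sum>j\<in>{1..p}. a i j * x j l)"
      unfolding B_def sum_distrib_left
      by (intro sum.cong refl) (simp add: scaled_t[OF _ l, symmetric])
    then have "l + c * (\<Sum>j\<in>{1..p}. a i j * x j l) = l * (1 + B i l)"
      by (simp add: algebra_simps)
    moreover have "u i l = (l * u i l) / l" using l by simp
    ultimately show ?thesis unfolding scaled_u[OF i l] by simp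
  qed
  have pos: "0 < l + c * (\<Sum>j\<in>{1..p}. a i j * x j l)"
    using u_pos[OF i l] unfolding u_eq[OF l] by (simp only: zero_less_divide_1_iff)
  have "((\<lambda>l. l + c * (\<Sum>j\<in>{1..p}. a i j * x j l)) has_real_derivative
      1 + c * (\<Sum>j\<in>{1..p}. a i j * x' j l)) (at l)"
    by (intro DERIV_add DERIV_ident DERIV_cmult DERIV_sum has_real_derivative_x l)
  from DERIV_divide[OF DERIV_const[of 1] this less_imp_neq[OF pos, symmetric]]
  have "((\<lambda>l. 1 / (l + c * (\<Sum>j\<in>{1..p}. a i j * x j l))) has_real_derivative
      - ((u i l)\<^sup>2 * (1 + c * (\<Sum>j\<in>{1..p}. a i j * x' j l)))) (at l)"
    by (rule DERIV_cong, unfold u_eq[OF l]) (simp add: power2_eq_square minus_divide_left)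
  moreover have "\<forall>\<^sub>F l in nhds l. u i l = 1 / (l + c * (\<Sum>j\<in>{1..p}. a i j * x j l))"
    using eventually_nhds_in_open[of "{0<..}" l] l
    by (intro eventually_mono[of "\<lambda>l. l \<in> {0<..}", OF _ u_eq]) auto
  ultimately have "(u i has_real_derivative - ((u i l)\<^sup>2 * (1 + c * (\<Sum>j\<in>{1..p}. a i j * x' j l)))) (at l)"
    by (subst DERIV_cong_ev[OF refl _ refl])
  then have "- v i l = - ((u i l)\<^sup>2 * (1 + c * (\<Sum>j\<in>{1..p}. a i j * x' j l)))"
    by (rule DERIV_unique[OF nonneg_distribution.has_real_derivative_moment[OF row_distribution[OF i] l]])
  then show ?thesis by simp
qed

section \<open>Limits and uniform bounds\<close>

lemma x_limit:
  assumes "j \<in> {1..p}" "(t j \<longlongrightarrow> L) (at_right 0)"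
  shows "(x j \<longlongrightarrow> 0) (at_right 0)"
proof -
  have "((\<lambda>l. l * t j l) \<longlongrightarrow> 0 * L) (at_right 0)"
    by (intro tendsto_intros assms)
  moreover have "\<forall>\<^sub>F l in at_right 0. l * t j l = x j l"
    using scaled_t[OF assms(1)] by (auto simp: eventually_at_right_field intro!: exI[of _ 1])
  ultimately show ?thesis by (simp add: tendsto_cong)
qed

text \<open>Each \<open>u i l\<close> is at most \<open>1 / l\<close>, so \<open>A j l\<close>
  vanishes at infinity.\<close>

lemma x_at_top: "((\<lambda>l. x j l) \<longlongrightarrow> 1) at_top"
proof -
  have "((\<lambda>l. u i l) \<longlongrightarrow> 0) at_top" if "i \<in> {1..n}" for i
  proof (rule tendsto_sandwich)
    show "\<forall>\<^sub>F l in at_top. 0 \<le> u i l"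
      using u_nonneg[OF that] by (auto intro!: eventually_mono[OF eventually_gt_at_top[of 0]])
    show "\<forall>\<^sub>F l in at_top. u i l \<le> 1 / l"
      using nonneg_distribution.moment_le[OF row_distribution[OF that]]
      by (auto intro!: eventually_mono[OF eventually_gt_at_top[of 0]])
    show "((\<lambda>l::real. 1 / l) \<longlongrightarrow> 0) at_top" by real_asymp
  qed simp
  then have "((\<lambda>l. 1 / (1 + A j l)) \<longlongrightarrow> 1 / (1 + c * (\<Sum>i\<in>{1..n}. a i j * 0))) at_top"
    unfolding A_def by (intro tendsto_intros) auto
  then show ?thesis unfolding x_def by simp
qed

lemma scaled_second_moment_at_top:
  assumes j: "j \<in> {1..p}"
  shows "((\<lambda>l. l\<^sup>2 * moment (\<mu> j) 2 l) \<longlongrightarrow> 1) at_top"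
proof (rule tendsto_sandwich)
  interpret nonneg_distribution "\<mu> j" by (rule column_distribution[OF j])
  show "\<forall>\<^sub>F l in at_top. 2 * x j l - 1 \<le> l\<^sup>2 * moment (\<mu> j) 2 l"
    using second_moment_ge scaled_t[OF j] by (auto intro!: eventually_mono[OF eventually_gt_at_top[of 0]])
  show "\<forall>\<^sub>F l in at_top. l\<^sup>2 * moment (\<mu> j) 2 l \<le> x j l"
    using second_moment_le scaled_t[OF j] by (auto intro!: eventually_mono[OF eventually_gt_at_top[of 0]])
  have "((\<lambda>l. 2 * x j l - 1) \<longlongrightarrow> 2 * 1 - 1) at_top" by (intro tendsto_intros x_at_top)
  then show "((\<lambda>l. 2 * x j l - 1) \<longlongrightarrow> 1) at_top" by simp
qed (rule x_at_top)

text \<open>Differentiating the fixed-point system gives a nonnegative linear system \<open>v = u\<^sup>2 + M v\<close>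
  for which \<open>u\<close> is a strict supersolution; comparing at the maximal ratio \<open>v / u\<close> bounds \<open>v\<close>.\<close>

lemma v_le:
  assumes l: "0 < l" and b: "0 < b"
    and lower: "\<And>i. i \<in> {1..n} \<Longrightarrow> b \<le> c * (\<Sum>j\<in>{1..p}. a i j * (x j l)\<^sup>2)"
    and k: "k \<in> {1..n}"
  shows "v k l \<le> u k l / b"
proof -
  define m where "m = Max ((\<lambda>i. v i l / u i l) ` {1..n})"
  have "m \<in> (\<lambda>i. v i l / u i l) ` {1..n}"
    unfolding m_def using n_pos by (intro Max_in) auto
  then obtain i where i: "i \<in> {1..n}" and mi: "m = v i l / u i l" by auto
  have m_ge: "v k l \<le> m * u k l" if "k \<in> {1..n}" for k
  proof -
    have "v k l / u k l \<le> m" unfolding m_def using that by (intro Max_ge) auto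
    then show ?thesis using u_pos[OF that l] by (simp add: field_simps)
  qed
  have m_nonneg: "0 \<le> m"
    unfolding mi by (intro divide_nonneg_nonneg u_nonneg v_nonneg i l)
  \<comment> \<open>Maximality of \<open>m\<close> gives \<open>W \<le> m * A\<close>, and
    \<open>x * A = 1 - x\<close> then supplies the factor \<open>1 - x\<close>. This factor, rather
    than 1, is the gain that appears as \<open>Q\<close> below.\<close>
  have x'_le: "x' j l \<le> m * (x j l * (1 - x j l))" for j
  proof -
    have "(\<Sum>k\<in>{1..n}. a k j * v k l) \<le> (\<Sum>k\<in>{1..n}. a k j * (m * u k l))"
      by (intro sum_mono mult_left_mono m_ge a_nonneg)
    also have "\<dots> = m * (\<Sum>k\<in>{1..n}. a k j * u k l)"
      by (simp add: sum_distrib_left mult_ac)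
    finally have "W j l \<le> m * A j l"
      using c_pos by (simp add: A_def W_def mult.left_commute)
    then have "x' j l \<le> (x j l)\<^sup>2 * (m * A j l)"
      unfolding x'_def by (intro mult_left_mono) auto
    also have "\<dots> = m * x j l * (x j l * A j l)" by (simp add: power2_eq_square)
    finally show ?thesis unfolding x_times_A[OF l] by (simp add: mult_ac)
  qed
  \<comment> \<open>\<open>P\<close> is \<open>l * B i l\<close>, so the row equation reads
    \<open>u i l * (l + P) = 1\<close>. Using it to expand \<open>m\<close> cancels \<open>P\<close>
    and leaves \<open>(l + Q) * m \<le> 1\<close>, where \<open>Q\<close> is at least
    \<open>b\<close>.\<close>
  define P where "P = c * (\<Sum>j\<in>{1..p}. a i j * x j l)"
  define Q where "Q = c * (\<Sum>j\<in>{1..p}. a i j * (x j l)\<^sup>2)"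
  have "(\<Sum>j\<in>{1..p}. a i j * x' j l) \<le> (\<Sum>j\<in>{1..p}. a i j * (m * (x j l * (1 - x j l))))"
    by (intro sum_mono mult_left_mono x'_le a_nonneg)
  then have "c * (\<Sum>j\<in>{1..p}. a i j * x' j l)
      \<le> c * (\<Sum>j\<in>{1..p}. a i j * (m * (x j l * (1 - x j l))))"
    using c_pos by (intro mult_left_mono) auto
  also have "\<dots> = m * (P - Q)"
    unfolding P_def Q_def sum_distrib_left sum_subtractf[symmetric]
    by (intro sum.cong) (auto simp: power2_eq_square algebra_simps)
  finally have "v i l \<le> (u i l)\<^sup>2 * (1 + m * (P - Q))"
    unfolding v_eq[OF i l] by (intro mult_left_mono) auto
  moreover have "v i l = m * u i l"
    using u_pos[OF i l] by (simp add: mi)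
  ultimately have "u i l * m \<le> u i l * (u i l * (1 + m * (P - Q)))"
    by (simp add: power2_eq_square mult_ac)
  then have *: "m \<le> u i l * (1 + m * (P - Q))"
    using u_pos[OF i l] by simp
  have lB: "l * B i l = P"
    unfolding B_def P_def sum_distrib_left
    by (intro sum.cong refl) (simp add: scaled_t[OF _ l, symmetric])
  have "u i l * (l + P) = l * u i l * (1 + B i l)"
    unfolding lB[symmetric] by (simp add: algebra_simps)
  also have "\<dots> = 1" unfolding scaled_u[OF i l] using B_nonneg[OF l, of i] by simp
  finally have "u i l * (l + P) = 1" .
  then have "m = u i l * (l + P) * m" by simp
  with * have "u i l * ((l + Q) * m) \<le> u i l * 1"
    by (simp add: algebra_simps)
  then have "(l + Q) * m \<le> 1" using u_pos[OF i l] by (simp only: mult_le_cancel_left_pos)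
  moreover have "b * m \<le> (l + Q) * m"
    using lower[OF i] l m_nonneg unfolding Q_def by (intro mult_right_mono) auto
  ultimately have "m \<le> 1 / b" using b by (simp add: field_simps)
  from mult_right_mono[OF this u_nonneg[OF k l]] m_ge[OF k] show ?thesis by simp
qed

text \<open>This is \<open>t_bounded\<close> for the system with rows and columns exchanged.\<close>

lemma u_bounded:
  assumes "n < p" "0 < m" and "\<And>i j. i \<in> {1..n} \<Longrightarrow> j \<in> {1..p} \<Longrightarrow> m \<le> a i j"
    and "i \<in> {1..n}" and "0 < l"
  shows "u i l \<le> real p / ((real p - real n) * c * m)"
proof -
  interpret swapped: variance_profile p n c "\<lambda>i j. a j i" \<nu> \<mu>
    by (rule variance_profile.intro) (intro n_pos p_pos c_pos a_nonneg row_distribution column_distribution row_equation column_equation; assumption)+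
  show ?thesis using assms by (intro swapped.t_bounded) auto
qed

lemma t_converges:
  assumes "p < n" "0 < m" and "\<And>i j. i \<in> {1..n} \<Longrightarrow> j \<in> {1..p} \<Longrightarrow> m \<le> a i j" and j: "j \<in> {1..p}"
  shows "\<exists>L. (t j \<longlongrightarrow> L) (at_right 0)"
  using nonneg_distribution.moment_limit[OF column_distribution[OF j] t_bounded[OF assms]] by blast

text \<open>Bounded row moments \<open>u\<close> give finite limits \<open>A0\<close>, which keep
  \<open>x\<close> at least \<open>1 / (1 + A0)\<close>. That lower bound makes \<open>v_le\<close>
  uniform in \<open>l\<close>, so the monotone moments \<open>v\<close> converge as well. Positivity
  of \<open>A0\<close> is recorded because \<open>kappa\<close> divides by \<open>A\<close>.\<close>

lemma A_W_converge:
  assumes "n < p" "0 < m" and m: "\<And>i j. i \<in> {1..n} \<Longrightarrow> j \<in> {1..p} \<Longrightarrow> m \<le> a i j"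
  shows "\<exists>A0 W0. \<forall>j\<in>{1..p}. 0 < A0 j \<and> (A j \<longlongrightarrow> A0 j) (at_right 0) \<and> (W j \<longlongrightarrow> W0 j) (at_right 0)"
proof -
  have "\<forall>i\<in>{1..n}. \<exists>L. (u i \<longlongrightarrow> L) (at_right 0) \<and> (\<forall>l>0. u i l \<le> L)"
    using nonneg_distribution.moment_limit[OF row_distribution u_bounded[OF assms]] by blast
  then obtain u0 where u0: "\<And>i. i \<in> {1..n} \<Longrightarrow> (u i \<longlongrightarrow> u0 i) (at_right 0)"
      "\<And>i l. i \<in> {1..n} \<Longrightarrow> 0 < l \<Longrightarrow> u i l \<le> u0 i"
    by metis
  have u0_pos: "0 < u0 i" if "i \<in> {1..n}" for i
    using u_pos[OF that, of 1] u0(2)[OF that, of 1] by simp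
  define A0 where "A0 j = c * (\<Sum>i\<in>{1..n}. a i j * u0 i)" for j
  have A0_pos: "0 < A0 j" if "j \<in> {1..p}" for j
    unfolding A0_def
    using m that assms(2) n_pos by (intro mult_pos_pos c_pos sum_pos u0_pos) (auto intro: less_le_trans)
  have A_le: "A j l \<le> A0 j" if "0 < l" for j l
    unfolding A_def A0_def using c_pos that
    by (intro mult_left_mono sum_mono u0(2) a_nonneg) auto
  \<comment> \<open>Obtained by inserting \<open>a \<ge> m\<close> and
    \<open>x \<ge> 1 / (1 + A0)\<close> into the sum that \<open>v_le\<close> requires to be bounded
    below; it is independent of both \<open>i\<close> and \<open>l\<close>.\<close>
  define b where "b = c * (\<Sum>j\<in>{1..p}. m * (1 / (1 + A0 j))\<^sup>2)"
  have b: "0 < b"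
    unfolding b_def using p_pos assms(2)
    by (intro mult_pos_pos c_pos sum_pos zero_less_power divide_pos_pos add_pos_pos A0_pos) auto
  have lower: "b \<le> c * (\<Sum>j\<in>{1..p}. a i j * (x j l)\<^sup>2)" if "i \<in> {1..n}" "0 < l" for i l
    unfolding b_def x_def
  proof (intro mult_left_mono sum_mono mult_mono power_mono m a_nonneg divide_left_mono add_left_mono A_le)
    fix j assume j: "j \<in> {1..p}"
    show "0 < (1 + A0 j) * (1 + A j l)"
      using A0_pos[OF j] A_nonneg[OF that(2), of j] by (intro mult_pos_pos) auto
    show "0 \<le> 1 / (1 + A0 j)" using A0_pos[OF j] by simp
  qed (use that c_pos in auto)
  have "v i l \<le> u0 i / b" if i: "i \<in> {1..n}" and l: "0 < l" for i l
    using v_le[OF l b lower[OF _ l] i] divide_right_mono[OF u0(2)[OF i l], of b] b by simp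
  then have "\<forall>i\<in>{1..n}. \<exists>L. (v i \<longlongrightarrow> L) (at_right 0)"
    using nonneg_distribution.moment_limit[OF row_distribution] by blast
  then obtain v0 where v0: "\<And>i. i \<in> {1..n} \<Longrightarrow> (v i \<longlongrightarrow> v0 i) (at_right 0)"
    by metis
  have "((\<lambda>l. A j l) \<longlongrightarrow> A0 j) (at_right 0)" for j
    unfolding A_def A0_def by (intro tendsto_intros u0)
  moreover have "((\<lambda>l. W j l) \<longlongrightarrow> c * (\<Sum>i\<in>{1..n}. a i j * v0 i)) (at_right 0)" for j
    unfolding W_def by (intro tendsto_intros v0)
  ultimately show ?thesis
    using A0_pos by (intro exI[of _ A0] exI[of _ "\<lambda>j. c * (\<Sum>i\<in>{1..n}. a i j * v0 i)"]) simp
qed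

end

section \<open>From complex transforms to real moments\<close>

lemma stieltjes_transform_nonneg_obtain:
  assumes "stieltjes_transform_nonneg f"
  obtains \<mu> where "nonneg_distribution \<mu>"
    and "\<And>l. 0 < l \<Longrightarrow> f (- of_real l) = of_real (moment \<mu> 1 l)"
    and "\<And>l. 0 < l \<Longrightarrow> deriv f (- of_real l) = of_real (moment \<mu> 2 l)"
proof -
  from assms obtain \<mu> where \<mu>: "real_distribution \<mu>" "measure \<mu> {0..} = 1"
      and f: "\<And>z. z \<notin> \<real>\<^sub>\<ge>\<^sub>0 \<Longrightarrow> f z = (\<integral>t. 1 / (complex_of_real t - z) \<partial>\<mu>)"
    unfolding stieltjes_transform_nonneg_def by blast
  have d: "nonneg_distribution \<mu>"
    using \<mu> by (simp add: nonneg_distribution_def nonneg_distribution_axioms_def)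
  show thesis
    using nonneg_distribution.stieltjes_has_field_derivative[OF d f]
    by (intro that[OF d] DERIV_imp_deriv)
qed

text \<open>At \<open>z = - l\<close> every transform is a real moment, so the complex system
  becomes the real system of \<open>variance_profile\<close> with
  \<open>c = 1 / real n\<close>.\<close>

lemma fixed_point_solution_obtain:
  assumes n: "n \<ge> 1" and p: "p \<ge> 1" and sol: "fixed_point_solution n p \<Upsilon> T Tt"
  obtains \<mu> \<nu> where "variance_profile n p (1 / real n) (\<lambda>i j. (\<Upsilon> i j)\<^sup>2) \<mu> \<nu>"
    and "\<And>j l. j \<in> {1..p} \<Longrightarrow> 0 < l \<Longrightarrow> T j (- of_real l) = of_real (moment (\<mu> j) 1 l)"
    and "\<And>j l. j \<in> {1..p} \<Longrightarrow> 0 < l \<Longrightarrow> deriv (T j) (- of_real l) = of_real (moment (\<mu> j) 2 l)"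
    and "\<And>i l. i \<in> {1..n} \<Longrightarrow> 0 < l \<Longrightarrow> Tt i (- of_real l) = of_real (moment (\<nu> i) 1 l)"
proof -
  have "\<forall>j\<in>{1..p}. \<exists>\<mu>. nonneg_distribution \<mu> \<and>
      (\<forall>l>0. T j (- of_real l) = of_real (moment \<mu> 1 l) \<and> deriv (T j) (- of_real l) = of_real (moment \<mu> 2 l))"
    using sol stieltjes_transform_nonneg_obtain unfolding fixed_point_solution_def by metis
  then obtain \<mu> where \<mu>: "\<And>j. j \<in> {1..p} \<Longrightarrow> nonneg_distribution (\<mu> j)"
      "\<And>j l. j \<in> {1..p} \<Longrightarrow> 0 < l \<Longrightarrow> T j (- of_real l) = of_real (moment (\<mu> j) 1 l)"
      "\<And>j l. j \<in> {1..p} \<Longrightarrow> 0 < l \<Longrightarrow> deriv (T j) (- of_real l) = of_real (moment (\<mu> j) 2 l)"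
    by metis
  have "\<forall>i\<in>{1..n}. \<exists>\<nu>. nonneg_distribution \<nu> \<and> (\<forall>l>0. Tt i (- of_real l) = of_real (moment \<nu> 1 l))"
    using sol stieltjes_transform_nonneg_obtain unfolding fixed_point_solution_def by metis
  then obtain \<nu> where \<nu>: "\<And>i. i \<in> {1..n} \<Longrightarrow> nonneg_distribution (\<nu> i)"
      "\<And>i l. i \<in> {1..n} \<Longrightarrow> 0 < l \<Longrightarrow> Tt i (- of_real l) = of_real (moment (\<nu> i) 1 l)"
    by metis
  have off: "- complex_of_real l \<notin> \<real>\<^sub>\<ge>\<^sub>0" if "0 < l" for l
    using that by (simp add: complex_nonneg_Reals_iff)
  \<comment> \<open>The minus signs in the numerator and in \<open>z = - l\<close> cancel, and
    injectivity of \<open>of_real\<close> brings the equation down to the reals.\<close>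
  have scale: "l * s = 1 / (1 + 1 / real n * S)"
    if "complex_of_real s = - 1 / (- of_real l * (1 + 1 / of_nat n * of_real S))" "0 < l" for l s S
  proof -
    have "complex_of_real s = of_real (1 / (l * (1 + 1 / real n * S)))"
      using that(1) by simp
    then have "s = 1 / (l * (1 + 1 / real n * S))" by (simp only: of_real_eq_iff)
    then show ?thesis using that(2) by simp
  qed
  have "variance_profile n p (1 / real n) (\<lambda>i j. (\<Upsilon> i j)\<^sup>2) \<mu> \<nu>"
    proof (rule variance_profile.intro)
      fix j l assume j: "j \<in> {1..p}" and l: "0 < (l::real)"
      show "l * moment (\<mu> j) 1 l =
          1 / (1 + 1 / real n * (\<Sum>i\<in>{1..n}. (\<Upsilon> i j)\<^sup>2 * moment (\<nu> i) 1 l))"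
      proof (rule scale[OF _ l])
        have "T j (- of_real l) = - 1 / (- of_real l *
            (1 + 1 / of_nat n * (\<Sum>i\<in>{1..n}. of_real ((\<Upsilon> i j)\<^sup>2) * Tt i (- of_real l))))"
          using sol off[OF l] j unfolding fixed_point_solution_def by blast
        then show "complex_of_real (moment (\<mu> j) 1 l) = - 1 / (- of_real l *
            (1 + 1 / of_nat n * of_real (\<Sum>i\<in>{1..n}. (\<Upsilon> i j)\<^sup>2 * moment (\<nu> i) 1 l)))"
          by (simp only: \<mu>(2)[OF j l] \<nu>(2)[OF _ l] of_real_sum of_real_mult cong: sum.cong)
      qed
    next
      fix i l assume i: "i \<in> {1..n}" and l: "0 < (l::real)"
      show "l * moment (\<nu> i) 1 l =
          1 / (1 + 1 / real n * (\<Sum>j\<in>{1..p}. (\<Upsilon> i j)\<^sup>2 * moment (\<mu> j) 1 l))"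
      proof (rule scale[OF _ l])
        have "Tt i (- of_real l) = - 1 / (- of_real l *
            (1 + 1 / of_nat n * (\<Sum>j\<in>{1..p}. of_real ((\<Upsilon> i j)\<^sup>2) * T j (- of_real l))))"
          using sol off[OF l] i unfolding fixed_point_solution_def by blast
        then show "complex_of_real (moment (\<nu> i) 1 l) = - 1 / (- of_real l *
            (1 + 1 / of_nat n * of_real (\<Sum>j\<in>{1..p}. (\<Upsilon> i j)\<^sup>2 * moment (\<mu> j) 1 l)))"
          by (simp only: \<nu>(2)[OF i l] \<mu>(2)[OF _ l] of_real_sum of_real_mult cong: sum.cong)
      qed
    qed (use n p in \<open>auto intro: \<mu>(1) \<nu>(1)\<close>)
  then show thesis by (rule that) (fact \<mu>(2) \<mu>(3) \<nu>(2))+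
qed

section \<open>The risk and its three limits\<close>

text \<open>Here \<open>g\<close> is the test profile. The transforms are recorded only at negative
  real arguments, where \<open>risk_equiv\<close> and \<open>kappa\<close> evaluate them for a
  positive penalty.\<close>

locale ridge_profile = variance_profile n p "1 / real n" "\<lambda>i j. (\<Upsilon> i j)\<^sup>2" \<mu> \<nu>
  for n p :: nat and \<Upsilon> :: "nat \<Rightarrow> nat \<Rightarrow> real" and \<mu> \<nu> :: "nat \<Rightarrow> real measure" +
  fixes T Tt :: "nat \<Rightarrow> complex \<Rightarrow> complex" and \<sigma> \<alpha> :: real and g :: "nat \<Rightarrow> real"
  assumes T_eq: "\<And>j l. j \<in> {1..p} \<Longrightarrow> 0 < l \<Longrightarrow> T j (- of_real l) = of_real (moment (\<mu> j) 1 l)"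
    and deriv_T_eq: "\<And>j l. j \<in> {1..p} \<Longrightarrow> 0 < l \<Longrightarrow> deriv (T j) (- of_real l) = of_real (moment (\<mu> j) 2 l)"
    and Tt_eq: "\<And>i l. i \<in> {1..n} \<Longrightarrow> 0 < l \<Longrightarrow> Tt i (- of_real l) = of_real (moment (\<nu> i) 1 l)"
begin

text \<open>Collecting by \<open>\<sigma>\<^sup>2\<close> and \<open>\<alpha>\<^sup>2\<close>, the
  variance weight is \<open>t j l - l * moment (\<mu> j) 2 l\<close>, which is \<open>x'\<close>,
  and the bias weight is \<open>l\<^sup>2 * moment (\<mu> j) 2 l\<close>, which is
  \<open>x j l - l * x' j l\<close>. Neither form contains the possibly divergent
  \<open>t\<close>.\<close>

lemma risk_eq:
  assumes l: "0 < l"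
  shows "risk_equiv \<sigma> \<alpha> n p g T l = of_real (\<sigma>\<^sup>2 + \<sigma>\<^sup>2 / real n * (\<Sum>j\<in>{1..p}. (g j)\<^sup>2 * x' j l)
    + \<alpha>\<^sup>2 / real p * (\<Sum>j\<in>{1..p}. (g j)\<^sup>2 * (x j l - l * x' j l)))"
proof -
  have "risk_equiv \<sigma> \<alpha> n p g T l = of_real (\<sigma>\<^sup>2 + \<sigma>\<^sup>2 / real n * (\<Sum>j\<in>{1..p}. (g j)\<^sup>2 * t j l)
    + l * (l * \<alpha>\<^sup>2 / real p - \<sigma>\<^sup>2 / real n) * (\<Sum>j\<in>{1..p}. (g j)\<^sup>2 * moment (\<mu> j) 2 l))"
    unfolding risk_equiv_def using l by (simp add: T_eq deriv_T_eq del: One_nat_def)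
  also have "\<sigma>\<^sup>2 + \<sigma>\<^sup>2 / real n * (\<Sum>j\<in>{1..p}. (g j)\<^sup>2 * t j l)
      + l * (l * \<alpha>\<^sup>2 / real p - \<sigma>\<^sup>2 / real n) * (\<Sum>j\<in>{1..p}. (g j)\<^sup>2 * moment (\<mu> j) 2 l)
    = \<sigma>\<^sup>2 + \<sigma>\<^sup>2 / real n * (\<Sum>j\<in>{1..p}. (g j)\<^sup>2 * (t j l - l * moment (\<mu> j) 2 l))
      + \<alpha>\<^sup>2 / real p * (\<Sum>j\<in>{1..p}. (g j)\<^sup>2 * (l * (l * moment (\<mu> j) 2 l)))"
  proof -
    define S1 S2 where "S1 = (\<Sum>j\<in>{1..p}. (g j)\<^sup>2 * t j l)"
      and "S2 = (\<Sum>j\<in>{1..p}. (g j)\<^sup>2 * moment (\<mu> j) 2 l)"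
    have "(\<Sum>j\<in>{1..p}. (g j)\<^sup>2 * (t j l - l * moment (\<mu> j) 2 l)) = S1 - l * S2"
      unfolding S1_def S2_def by (simp add: right_diff_distrib sum_subtractf sum_distrib_left mult.left_commute)
    moreover have "(\<Sum>j\<in>{1..p}. (g j)\<^sup>2 * (l * (l * moment (\<mu> j) 2 l))) = l * (l * S2)"
      unfolding S2_def by (simp add: sum_distrib_left mult.left_commute)
    ultimately show ?thesis
      unfolding S1_def[symmetric] S2_def[symmetric]
      by (simp only:) (simp add: algebra_simps diff_divide_distrib power2_eq_square)
  qed
  also have "(\<Sum>j\<in>{1..p}. (g j)\<^sup>2 * (t j l - l * moment (\<mu> j) 2 l)) = (\<Sum>j\<in>{1..p}. (g j)\<^sup>2 * x' j l)"
    by (intro sum.cong refl) (simp add: second_moment_t_eq[OF _ l])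
  also have "(\<Sum>j\<in>{1..p}. (g j)\<^sup>2 * (l * (l * moment (\<mu> j) 2 l)))
      = (\<Sum>j\<in>{1..p}. (g j)\<^sup>2 * (x j l - l * x' j l))"
    by (intro sum.cong refl) (simp add: second_moment_t_eq[OF _ l] scaled_t[OF _ l, symmetric] right_diff_distrib)
  finally show ?thesis .
qed

text \<open>The filter is left general so that the limit at infinity and both limits at 0 reduce to
  columnwise limits \<open>D\<close> of the variance weights and \<open>E\<close> of the bias
  weights.\<close>

lemma risk_tendsto:
  assumes "\<And>j. j \<in> {1..p} \<Longrightarrow> (x' j \<longlongrightarrow> D j) F"
    and "\<And>j. j \<in> {1..p} \<Longrightarrow> ((\<lambda>l. x j l - l * x' j l) \<longlongrightarrow> E j) F"
    and "\<forall>\<^sub>F l in F. 0 < l"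
  shows "(risk_equiv \<sigma> \<alpha> n p g T \<longlongrightarrow> of_real (\<sigma>\<^sup>2 + \<sigma>\<^sup>2 / real n * (\<Sum>j\<in>{1..p}. (g j)\<^sup>2 * D j)
    + \<alpha>\<^sup>2 / real p * (\<Sum>j\<in>{1..p}. (g j)\<^sup>2 * E j))) F"
proof (rule Lim_transform_eventually)
  show "((\<lambda>l. complex_of_real (\<sigma>\<^sup>2 + \<sigma>\<^sup>2 / real n * (\<Sum>j\<in>{1..p}. (g j)\<^sup>2 * x' j l)
    + \<alpha>\<^sup>2 / real p * (\<Sum>j\<in>{1..p}. (g j)\<^sup>2 * (x j l - l * x' j l)))) \<longlongrightarrow>
    of_real (\<sigma>\<^sup>2 + \<sigma>\<^sup>2 / real n * (\<Sum>j\<in>{1..p}. (g j)\<^sup>2 * D j)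
    + \<alpha>\<^sup>2 / real p * (\<Sum>j\<in>{1..p}. (g j)\<^sup>2 * E j))) F"
    by (intro tendsto_of_real tendsto_add tendsto_mult tendsto_sum tendsto_const assms)
  show "\<forall>\<^sub>F l in F. complex_of_real (\<sigma>\<^sup>2 + \<sigma>\<^sup>2 / real n * (\<Sum>j\<in>{1..p}. (g j)\<^sup>2 * x' j l)
    + \<alpha>\<^sup>2 / real p * (\<Sum>j\<in>{1..p}. (g j)\<^sup>2 * (x j l - l * x' j l))) = risk_equiv \<sigma> \<alpha> n p g T l"
    using assms(3) by eventually_elim (rule risk_eq[symmetric])
qed

lemma x_minus_scaled_eq: "j \<in> {1..p} \<Longrightarrow> 0 < l \<Longrightarrow> x j l - l * x' j l = l\<^sup>2 * moment (\<mu> j) 2 l"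
  using second_moment_t_eq[of j l] scaled_t[of j l]
  by (simp add: power2_eq_square mult.assoc right_diff_distrib)

lemma risk_at_top:
  "(risk_equiv \<sigma> \<alpha> n p g T \<longlongrightarrow> of_real (\<alpha>\<^sup>2 / real p * (\<Sum>j\<in>{1..p}. (g j)\<^sup>2) + \<sigma>\<^sup>2)) at_top"
proof -
  have ev: "\<forall>\<^sub>F l in at_top. 0 < (l::real)" by (rule eventually_gt_at_top)
  have E: "((\<lambda>l. x j l - l * x' j l) \<longlongrightarrow> 1) at_top" if j: "j \<in> {1..p}" for j
  proof (rule Lim_transform_eventually[OF scaled_second_moment_at_top[OF j]])
    show "\<forall>\<^sub>F l in at_top. l\<^sup>2 * moment (\<mu> j) 2 l = x j l - l * x' j l"
      using ev by eventually_elim (simp add: x_minus_scaled_eq[OF j])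
  qed
  \<comment> \<open>Both \<open>x\<close> and \<open>x - l * x'\<close> tend to 1, so their
    difference \<open>l * x'\<close> tends to 0, and dividing by \<open>l\<close> only
    helps.\<close>
  have D: "(x' j \<longlongrightarrow> 0) at_top" if j: "j \<in> {1..p}" for j
  proof -
    have "((\<lambda>l. (x j l - (x j l - l * x' j l)) * inverse l) \<longlongrightarrow> (1 - 1) * 0) at_top"
      by (intro tendsto_intros x_at_top E j tendsto_inverse_0_at_top filterlim_ident)
    moreover have "\<forall>\<^sub>F l in at_top. (x j l - (x j l - l * x' j l)) * inverse l = x' j l"
      using ev by eventually_elim simp
    ultimately have "(x' j \<longlongrightarrow> (1 - 1) * 0) at_top" by (rule Lim_transform_eventually)
    then show ?thesis by simp
  qed
  show ?thesis using risk_tendsto[OF D E ev] by (simp add: add.commute)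
qed

text \<open>The variance weight differs from \<open>t\<close> by \<open>l\<close> times the second
  moment, which vanishes by \<open>second_moment_scaled_tendsto_0\<close>; the bias weight vanishes
  because \<open>t\<close> stays bounded.\<close>

lemma risk_at_zero_less:
  assumes "p < n" "0 < m" "\<And>i j. i \<in> {1..n} \<Longrightarrow> j \<in> {1..p} \<Longrightarrow> m \<le> (\<Upsilon> i j)\<^sup>2"
  shows "\<exists>T0. (\<forall>j\<in>{1..p}. ((\<lambda>l. T j (- of_real l)) \<longlongrightarrow> T0 j) (at_right (0::real))) \<and>
    (risk_equiv \<sigma> \<alpha> n p g T \<longlongrightarrow>
      of_real (\<sigma>\<^sup>2 / real n) * (\<Sum>j\<in>{1..p}. of_real ((g j)\<^sup>2) * T0 j) + of_real (\<sigma>\<^sup>2)) (at_right 0)"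
proof -
  have ev: "\<forall>\<^sub>F l in at_right 0. 0 < (l::real)"
    by (simp add: eventually_at_right_less)
  obtain t0 where t0: "\<And>j. j \<in> {1..p} \<Longrightarrow> (t j \<longlongrightarrow> t0 j) (at_right 0)"
    using t_converges[OF assms] by metis
  have small: "((\<lambda>l. l * moment (\<mu> j) 2 l) \<longlongrightarrow> 0) (at_right 0)" if "j \<in> {1..p}" for j
    by (rule nonneg_distribution.second_moment_scaled_tendsto_0[OF column_distribution[OF that] t0[OF that]])
  have T0: "((\<lambda>l. T j (- of_real l)) \<longlongrightarrow> of_real (t0 j)) (at_right (0::real))" if j: "j \<in> {1..p}" for j
  proof (rule Lim_transform_eventually[OF tendsto_of_real[OF t0[OF j]]])
    show "\<forall>\<^sub>F l in at_right 0. complex_of_real (t j l) = T j (- of_real l)"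
      using ev by eventually_elim (simp add: T_eq[OF j] del: One_nat_def)
  qed
  have D: "(x' j \<longlongrightarrow> t0 j) (at_right 0)" if j: "j \<in> {1..p}" for j
  proof -
    have "((\<lambda>l. t j l - l * moment (\<mu> j) 2 l) \<longlongrightarrow> t0 j - 0) (at_right 0)"
      by (intro tendsto_diff t0 small j)
    moreover have "\<forall>\<^sub>F l in at_right 0. t j l - l * moment (\<mu> j) 2 l = x' j l"
      using ev by eventually_elim (simp add: second_moment_t_eq[OF j] del: One_nat_def)
    ultimately show ?thesis by (simp add: tendsto_cong)
  qed
  have E: "((\<lambda>l. x j l - l * x' j l) \<longlongrightarrow> 0) (at_right 0)" if j: "j \<in> {1..p}" for j
  proof -
    have "((\<lambda>l. x j l - l * x' j l) \<longlongrightarrow> 0 - 0 * t0 j) (at_right 0)"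
      by (intro tendsto_diff tendsto_mult tendsto_ident_at D j x_limit[OF j t0[OF j]])
    then show ?thesis by simp
  qed
  show ?thesis
    using risk_tendsto[OF D E ev] T0
    by (intro exI[of _ "\<lambda>j. of_real (t0 j)"]) (simp add: add.commute)
qed

text \<open>Numerator and denominator of \<open>kappa\<close> are both multiplied by
  \<open>1 / real n\<close>.\<close>

lemma kappa_eq:
  assumes "0 < l"
  shows "kappa n \<Upsilon> Tt j l = of_real (avg_variance n \<Upsilon> j / A j l)"
  unfolding kappa_def avg_variance_def A_def
  using assms n_pos by (simp add: Tt_eq del: One_nat_def)

text \<open>Here \<open>t\<close> diverges, so every limit is taken through \<open>A\<close> and
  \<open>W\<close> and then translated into \<open>kappa\<close> by \<open>kappa_eq\<close>.\<close>

lemma risk_at_zero_greater: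
  assumes "n < p" "0 < m" and m: "\<And>i j. i \<in> {1..n} \<Longrightarrow> j \<in> {1..p} \<Longrightarrow> m \<le> (\<Upsilon> i j)\<^sup>2"
  shows "\<exists>\<kappa>0 \<kappa>'0.
    (\<forall>j\<in>{1..p}. (kappa n \<Upsilon> Tt j \<longlongrightarrow> \<kappa>0 j) (at_right 0)) \<and>
    (\<forall>j\<in>{1..p}. ((\<lambda>lam. vector_derivative (kappa n \<Upsilon> Tt j) (at lam)) \<longlongrightarrow> \<kappa>'0 j) (at_right 0)) \<and>
    (risk_equiv \<sigma> \<alpha> n p g T \<longlongrightarrow>
       of_real (\<alpha>\<^sup>2 / real p) * (\<Sum>j\<in>{1..p}. of_real ((g j)\<^sup>2) * \<kappa>0 j
         * inverse (of_real (avg_variance n \<Upsilon> j) + \<kappa>0 j))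
       + of_real (\<sigma>\<^sup>2 / real n) * (\<Sum>j\<in>{1..p}. \<kappa>'0 j * of_real ((g j)\<^sup>2) * of_real (avg_variance n \<Upsilon> j)
         * (inverse (of_real (avg_variance n \<Upsilon> j) + \<kappa>0 j))\<^sup>2)
       + of_real (\<sigma>\<^sup>2)) (at_right 0)"
proof -
  have ev: "\<forall>\<^sub>F l in at_right 0. 0 < (l::real)"
    by (simp add: eventually_at_right_less)
  obtain A0 W0 where A0_pos: "\<And>j. j \<in> {1..p} \<Longrightarrow> 0 < A0 j"
      and A0: "\<And>j. j \<in> {1..p} \<Longrightarrow> (A j \<longlongrightarrow> A0 j) (at_right 0)"
      and W0: "\<And>j. j \<in> {1..p} \<Longrightarrow> (W j \<longlongrightarrow> W0 j) (at_right 0)"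
    using A_W_converge[OF assms] by blast
  define s where "s j = avg_variance n \<Upsilon> j" for j
  have s_pos: "0 < s j" if "j \<in> {1..p}" for j
    unfolding s_def avg_variance_def
    using n_pos by (intro mult_pos_pos sum_pos less_le_trans[OF assms(2) m] that) auto
  have A_pos: "0 < A j l" if "j \<in> {1..p}" "0 < l" for j l
    unfolding A_def
    using n_pos by (intro mult_pos_pos sum_pos u_pos less_le_trans[OF assms(2) m] that) auto
  define \<kappa>0 where "\<kappa>0 j = complex_of_real (s j / A0 j)" for j
  \<comment> \<open>The limit of the derivative of \<open>s j / A j l\<close>; the minus sign of the
    quotient rule cancels against the derivative \<open>- W\<close> of \<open>A\<close>.\<close>
  define \<kappa>'0 where "\<kappa>'0 j = complex_of_real (s j * W0 j / (A0 j)\<^sup>2)" for j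
  have \<kappa>0: "(kappa n \<Upsilon> Tt j \<longlongrightarrow> \<kappa>0 j) (at_right 0)" if j: "j \<in> {1..p}" for j
    unfolding \<kappa>0_def
  proof (rule Lim_transform_eventually)
    show "((\<lambda>l. complex_of_real (s j / A j l)) \<longlongrightarrow> of_real (s j / A0 j)) (at_right 0)"
      using A0_pos[OF j] by (intro tendsto_of_real tendsto_divide tendsto_const A0 j) simp
    show "\<forall>\<^sub>F l in at_right 0. complex_of_real (s j / A j l) = kappa n \<Upsilon> Tt j l"
      using ev by eventually_elim (simp add: kappa_eq s_def)
  qed
  have vd: "vector_derivative (kappa n \<Upsilon> Tt j) (at l) = of_real (s j * W j l / (A j l)\<^sup>2)"
    if j: "j \<in> {1..p}" and l: "0 < l" for j l
  proof (rule vector_derivative_at)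
    have "((\<lambda>l. s j / A j l) has_real_derivative s j * W j l / (A j l)\<^sup>2) (at l)"
      using A_pos[OF j l] has_real_derivative_A[OF l, of j]
      by (auto intro!: derivative_eq_intros simp: power2_eq_square)
    then have "((\<lambda>l. complex_of_real (s j / A j l)) has_vector_derivative
        of_real (s j * W j l / (A j l)\<^sup>2)) (at l)"
      by (rule has_vector_derivative_of_real)
    then show "(kappa n \<Upsilon> Tt j has_vector_derivative of_real (s j * W j l / (A j l)\<^sup>2)) (at l)"
      by (rule has_vector_derivative_transform_within_open[where S = "{0<..}"])
        (use l in \<open>auto simp: kappa_eq s_def\<close>)
  qed
  have \<kappa>'0: "((\<lambda>l. vector_derivative (kappa n \<Upsilon> Tt j) (at l)) \<longlongrightarrow> \<kappa>'0 j) (at_right 0)"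
    if j: "j \<in> {1..p}" for j
    unfolding \<kappa>'0_def
  proof (rule Lim_transform_eventually)
    show "((\<lambda>l. complex_of_real (s j * W j l / (A j l)\<^sup>2)) \<longlongrightarrow> of_real (s j * W0 j / (A0 j)\<^sup>2)) (at_right 0)"
      using A0_pos[OF j]
      by (intro tendsto_of_real tendsto_divide tendsto_mult tendsto_power tendsto_const A0 W0 j) simp
    show "\<forall>\<^sub>F l in at_right 0. complex_of_real (s j * W j l / (A j l)\<^sup>2)
        = vector_derivative (kappa n \<Upsilon> Tt j) (at l)"
      using ev by eventually_elim (simp only: vd[OF j])
  qed
  define \<xi> where "\<xi> j = 1 / (1 + A0 j)" for j
  have x: "((\<lambda>l. x j l) \<longlongrightarrow> \<xi> j) (at_right 0)" if j: "j \<in> {1..p}" for j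
    unfolding x_def \<xi>_def using A0_pos[OF j] by (intro tendsto_intros A0 j) simp
  have D: "((\<lambda>l. x' j l) \<longlongrightarrow> (\<xi> j)\<^sup>2 * W0 j) (at_right 0)" if j: "j \<in> {1..p}" for j
    unfolding x'_def by (intro tendsto_intros x W0 j)
  have E: "((\<lambda>l. x j l - l * x' j l) \<longlongrightarrow> \<xi> j) (at_right 0)" if j: "j \<in> {1..p}" for j
  proof -
    have "((\<lambda>l. x j l - l * x' j l) \<longlongrightarrow> \<xi> j - 0 * ((\<xi> j)\<^sup>2 * W0 j)) (at_right 0)"
      by (intro tendsto_diff tendsto_mult tendsto_ident_at x D j)
    then show ?thesis by simp
  qed
  \<comment> \<open>The dictionary between \<open>A0\<close> and \<open>\<kappa>0 = s / A0\<close>: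
    it gives \<open>\<xi> = \<kappa>0 / (s + \<kappa>0)\<close> for the bias and, after squaring,
    \<open>\<xi>\<^sup>2 * W0 = \<kappa>'0 * s / (s + \<kappa>0)\<^sup>2\<close> for the
    variance.\<close>
  have \<xi>: "inverse (s j + s j / A0 j) = \<xi> j * A0 j / s j" if j: "j \<in> {1..p}" for j
    unfolding \<xi>_def using A0_pos[OF j] s_pos[OF j] by (simp add: field_simps)
  have bias: "(g j)\<^sup>2 * \<xi> j = (g j)\<^sup>2 * (s j / A0 j) * inverse (s j + s j / A0 j)"
    if j: "j \<in> {1..p}" for j
    unfolding \<xi>[OF j] using A0_pos[OF j] s_pos[OF j] by simp
  have variance: "(g j)\<^sup>2 * ((\<xi> j)\<^sup>2 * W0 j)
      = (s j * W0 j / (A0 j)\<^sup>2) * (g j)\<^sup>2 * s j * (inverse (s j + s j / A0 j))\<^sup>2"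
    if j: "j \<in> {1..p}" for j
    unfolding \<xi>[OF j] using A0_pos[OF j] s_pos[OF j] by (simp add: power2_eq_square)
  have "(risk_equiv \<sigma> \<alpha> n p g T \<longlongrightarrow> of_real (\<alpha>\<^sup>2 / real p *
        (\<Sum>j\<in>{1..p}. (g j)\<^sup>2 * (s j / A0 j) * inverse (s j + s j / A0 j))
      + \<sigma>\<^sup>2 / real n *
        (\<Sum>j\<in>{1..p}. (s j * W0 j / (A0 j)\<^sup>2) * (g j)\<^sup>2 * s j * (inverse (s j + s j / A0 j))\<^sup>2)
      + \<sigma>\<^sup>2)) (at_right 0)"
    using risk_tendsto[OF D E ev]
    by (simp only: bias variance add.commute add.left_commute cong: sum.cong)
  then have "(risk_equiv \<sigma> \<alpha> n p g T \<longlongrightarrow>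
       of_real (\<alpha>\<^sup>2 / real p) * (\<Sum>j\<in>{1..p}. of_real ((g j)\<^sup>2) * \<kappa>0 j
         * inverse (of_real (s j) + \<kappa>0 j))
       + of_real (\<sigma>\<^sup>2 / real n) * (\<Sum>j\<in>{1..p}. \<kappa>'0 j * of_real ((g j)\<^sup>2) * of_real (s j)
         * (inverse (of_real (s j) + \<kappa>0 j))\<^sup>2)
       + of_real (\<sigma>\<^sup>2)) (at_right 0)"
    unfolding \<kappa>0_def \<kappa>'0_def
    by (simp only: of_real_add of_real_mult of_real_sum of_real_inverse of_real_power)
  with \<kappa>0 \<kappa>'0 show ?thesis
    unfolding s_def
    by (intro exI[of _ \<kappa>0] exI[of _ \<kappa>'0]) simp
qed

end

section \<open>Assembly for each sample size\<close>

theorem corollary3p3: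
  fixes M :: "'w measure"
    and p :: "nat \<Rightarrow> nat"
    and \<gamma> :: "nat \<Rightarrow> nat \<Rightarrow> nat \<Rightarrow> real"
    and \<gamma>t :: "nat \<Rightarrow> nat \<Rightarrow> real"
    and \<sigma> \<alpha> :: real
    and Z :: "nat \<Rightarrow> nat \<Rightarrow> nat \<Rightarrow> 'w \<Rightarrow> real"
    and \<beta> \<epsilon> Y zt :: "nat \<Rightarrow> nat \<Rightarrow> 'w \<Rightarrow> real"
    and \<epsilon>t yt :: "nat \<Rightarrow> 'w \<Rightarrow> real"
    and T Tt :: "nat \<Rightarrow> nat \<Rightarrow> complex \<Rightarrow> complex"
  assumes prob: "prob_space M"
    and p_pos: "\<And>n. n \<ge> 1 \<Longrightarrow> p n \<ge> 1"
    and noise: "\<sigma>\<^sup>2 > 0"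
    and model: "\<And>n. n \<ge> 1 \<Longrightarrow>
      regression_model M n (p n) (\<gamma> n) (\<gamma>t n) \<sigma> (Z n) (\<beta> n) (\<epsilon> n) (Y n) (zt n) (\<epsilon>t n) (yt n)"
    and solution: "\<And>n. n \<ge> 1 \<Longrightarrow> fixed_point_solution n (p n) (\<gamma> n) (T n) (Tt n)"
    and A1_pos: "\<alpha> > 0"
    and A1: "\<And>n. n \<ge> 1 \<Longrightarrow>
      random_coefficients M n (p n) (\<gamma> n) (\<gamma>t n) \<alpha> (Z n) (\<beta> n) (\<epsilon> n) (zt n) (\<epsilon>t n)"
    and A2: "\<exists>\<delta>>0. \<forall>n\<ge>1. \<forall>j\<in>{1..p n}.
      (\<forall>i\<in>{1..n}. integrable M (\<lambda>w. \<bar>Z n i j w\<bar> powr (4 + \<delta>))) \<and>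
      integrable M (\<lambda>w. \<bar>zt n j w\<bar> powr (4 + \<delta>))"
    and A3: "\<exists>\<gamma>max>0. \<exists>b<\<gamma>max. \<forall>n\<ge>1. \<forall>i\<in>{1..n}. \<forall>j\<in>{1..p n}.
      \<bar>\<gamma> n i j\<bar> \<le> b \<and> \<bar>\<gamma>t n j\<bar> \<le> b"
  shows
    "(\<forall>n\<ge>1. (risk_equiv \<sigma> \<alpha> n (p n) (\<gamma>t n) (T n) \<longlongrightarrow>
        of_real (\<alpha>\<^sup>2 / real (p n) * (\<Sum>j\<in>{1..p n}. (\<gamma>t n j)\<^sup>2) + \<sigma>\<^sup>2)) at_top) \<and>
     ((\<exists>\<gamma>min>0. \<forall>n\<ge>1. \<forall>i\<in>{1..n}. \<forall>j\<in>{1..p n}. \<gamma>min \<le> \<bar>\<gamma> n i j\<bar> \<and> \<gamma>min \<le> \<bar>\<gamma>t n j\<bar>) \<and>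
      (\<exists>d>0. \<forall>n\<ge>1. d \<le> \<bar>real (p n) / real n - 1\<bar>) \<longrightarrow>
      (\<forall>n\<ge>1.
        (real (p n) / real n < 1 \<longrightarrow>
          (\<exists>T0 :: nat \<Rightarrow> complex.
            (\<forall>j\<in>{1..p n}. ((\<lambda>lam. T n j (- of_real lam)) \<longlongrightarrow> T0 j) (at_right (0::real))) \<and>
            (risk_equiv \<sigma> \<alpha> n (p n) (\<gamma>t n) (T n) \<longlongrightarrow>
               of_real (\<sigma>\<^sup>2 / real n) * (\<Sum>j\<in>{1..p n}. of_real ((\<gamma>t n j)\<^sup>2) * T0 j)
               + of_real (\<sigma>\<^sup>2)) (at_right 0))) \<and>
        (real (p n) / real n > 1 \<longrightarrow>
          (\<exists>\<kappa>0 \<kappa>'0 :: nat \<Rightarrow> complex.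
            (\<forall>j\<in>{1..p n}. (kappa n (\<gamma> n) (Tt n) j \<longlongrightarrow> \<kappa>0 j) (at_right 0)) \<and>
            (\<forall>j\<in>{1..p n}.
              ((\<lambda>lam. vector_derivative (kappa n (\<gamma> n) (Tt n) j) (at lam)) \<longlongrightarrow> \<kappa>'0 j)
                (at_right 0)) \<and>
            (risk_equiv \<sigma> \<alpha> n (p n) (\<gamma>t n) (T n) \<longlongrightarrow>
               of_real (\<alpha>\<^sup>2 / real (p n)) *
                 (\<Sum>j\<in>{1..p n}. of_real ((\<gamma>t n j)\<^sup>2) * \<kappa>0 j
                    * inverse (of_real (avg_variance n (\<gamma> n) j) + \<kappa>0 j))
               + of_real (\<sigma>\<^sup>2 / real n) *
                 (\<Sum>j\<in>{1..p n}. \<kappa>'0 j * of_real ((\<gamma>t n j)\<^sup>2) * of_real (avg_variance n (\<gamma> n) j)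
                    * (inverse (of_real (avg_variance n (\<gamma> n) j) + \<kappa>0 j))\<^sup>2)
               + of_real (\<sigma>\<^sup>2)) (at_right 0)))))"
proof -
  have "\<exists>\<mu> \<nu>. ridge_profile n (p n) (\<gamma> n) \<mu> \<nu> (T n) (Tt n)" if n: "n \<ge> 1" for n
    using fixed_point_solution_obtain[OF n p_pos[OF n] solution[OF n]]
    unfolding ridge_profile_def ridge_profile_axioms_def by metis
  then obtain \<mu> \<nu> where profile: "\<And>n. n \<ge> 1 \<Longrightarrow> ridge_profile n (p n) (\<gamma> n) (\<mu> n) (\<nu> n) (T n) (Tt n)"
    by metis
  \<comment> \<open>(A4) bounds absolute values, whereas the estimates use the squared profile; the
    witness is the square of the lower bound.\<close>
  have bounds: "\<exists>m>0. \<forall>i\<in>{1..n}. \<forall>j\<in>{1..p n}. m \<le> (\<gamma> n i j)\<^sup>2"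
    if A4: "\<exists>\<gamma>min>0. \<forall>n\<ge>1. \<forall>i\<in>{1..n}. \<forall>j\<in>{1..p n}. \<gamma>min \<le> \<bar>\<gamma> n i j\<bar> \<and> \<gamma>min \<le> \<bar>\<gamma>t n j\<bar>"
      and n: "n \<ge> 1" for n
  proof -
    obtain c where c: "0 < c" "\<And>i j. i \<in> {1..n} \<Longrightarrow> j \<in> {1..p n} \<Longrightarrow> c \<le> \<bar>\<gamma> n i j\<bar>"
      using A4 n by blast
    then have "c\<^sup>2 \<le> (\<gamma> n i j)\<^sup>2" if "i \<in> {1..n}" "j \<in> {1..p n}" for i j
      using power_mono[OF c(2)[OF that], of 2] by simp
    with c(1) show ?thesis by (intro exI[of _ "c\<^sup>2"]) simp
  qed
  show ?thesis
  proof (intro conjI allI impI)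
    fix n :: nat assume "n \<ge> 1"
    then show "(risk_equiv \<sigma> \<alpha> n (p n) (\<gamma>t n) (T n) \<longlongrightarrow>
        of_real (\<alpha>\<^sup>2 / real (p n) * (\<Sum>j\<in>{1..p n}. (\<gamma>t n j)\<^sup>2) + \<sigma>\<^sup>2)) at_top"
      by (rule ridge_profile.risk_at_top[OF profile])
  next
    fix n :: nat assume A4: "(\<exists>\<gamma>min>0. \<forall>n\<ge>1. \<forall>i\<in>{1..n}. \<forall>j\<in>{1..p n}.
        \<gamma>min \<le> \<bar>\<gamma> n i j\<bar> \<and> \<gamma>min \<le> \<bar>\<gamma>t n j\<bar>) \<and> (\<exists>d>0. \<forall>n\<ge>1. d \<le> \<bar>real (p n) / real n - 1\<bar>)"
      and n: "n \<ge> 1"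
    obtain m where m: "0 < m" "\<And>i j. i \<in> {1..n} \<Longrightarrow> j \<in> {1..p n} \<Longrightarrow> m \<le> (\<gamma> n i j)\<^sup>2"
      using bounds[OF conjunct1[OF A4] n] by blast
    {
      assume "real (p n) / real n < 1"
      then have "p n < n" using n by (simp add: divide_simps)
      from ridge_profile.risk_at_zero_less[OF profile[OF n] this m]
      show "\<exists>T0. (\<forall>j\<in>{1..p n}. ((\<lambda>lam. T n j (- of_real lam)) \<longlongrightarrow> T0 j) (at_right (0::real))) \<and>
          (risk_equiv \<sigma> \<alpha> n (p n) (\<gamma>t n) (T n) \<longlongrightarrow>
             of_real (\<sigma>\<^sup>2 / real n) * (\<Sum>j\<in>{1..p n}. of_real ((\<gamma>t n j)\<^sup>2) * T0 j)
             + of_real (\<sigma>\<^sup>2)) (at_right 0)" .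
    next
      assume "real (p n) / real n > 1"
      then have "n < p n" using n by (simp add: divide_simps)
      from ridge_profile.risk_at_zero_greater[OF profile[OF n] this m]
      show "\<exists>\<kappa>0 \<kappa>'0.
          (\<forall>j\<in>{1..p n}. (kappa n (\<gamma> n) (Tt n) j \<longlongrightarrow> \<kappa>0 j) (at_right 0)) \<and>
          (\<forall>j\<in>{1..p n}. ((\<lambda>lam. vector_derivative (kappa n (\<gamma> n) (Tt n) j) (at lam)) \<longlongrightarrow> \<kappa>'0 j)
            (at_right 0)) \<and>
          (risk_equiv \<sigma> \<alpha> n (p n) (\<gamma>t n) (T n) \<longlongrightarrow>
             of_real (\<alpha>\<^sup>2 / real (p n)) * (\<Sum>j\<in>{1..p n}. of_real ((\<gamma>t n j)\<^sup>2) * \<kappa>0 j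
               * inverse (of_real (avg_variance n (\<gamma> n) j) + \<kappa>0 j))
             + of_real (\<sigma>\<^sup>2 / real n) *
               (\<Sum>j\<in>{1..p n}. \<kappa>'0 j * of_real ((\<gamma>t n j)\<^sup>2) * of_real (avg_variance n (\<gamma> n) j)
                 * (inverse (of_real (avg_variance n (\<gamma> n) j) + \<kappa>0 j))\<^sup>2)
             + of_real (\<sigma>\<^sup>2)) (at_right 0)" .
    }
  qed
qed

end
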